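(* Let $A$ and $B$ be finitely generated groups, and let $E_A:A\to\mathbb{R}$ and $E_B:B\to\mathbb{R}$ be estimates of the word metrics of $A$ and $B$ respectively. For $x\in A\wr B$ written in normal form $x=\left(\prod_{i=1}^s b_i a_i b_i^{-1}\right)b_f$, each of the following seven expressions, regarded as a function of $x\in A\wr B$, is an estimate of the word metric of $A\wr B$: 1. $\sum_{i=1}^s\lVert a_i\rVert_A+\mu(e,b_i,b_f)$; 2. $\sum_{i=1}^s E_A(a_i)+\tau(e,b_i,b_f)$; 3. $\sum_{i=1}^s E_A(a_i)+\mu(e,b_i,b_f)$; 4. $\sum_{i=1}^s\lVert a_i\rVert_A+\hat\mu(e,b_i,b_f)$; 5. $\sum_{i=1}^s E_A(a_i)+\hat\mu(e,b_i,b_f)$; 6. $\sum_{i=1}^s\lVert a_i\rVert_A+\mu(e,b_i,b_f)+E_B(b_f)$; 7. $\sum_{i=1}^s E_A(a_i)+\hat\mu(e,b_i,b_f)+E_B(b_f)$.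
   Context: For a finitely generated group $G$ with a fixed finite generating set, $\lVert g\rVert_G$ is the word length of $g$. Two functions $f,g:G\to\mathbb{R}$ are equivalent, $f\sim g$, if there are constants $C>0$ and $D\ge 0$ with $\frac{g}{C}-D\le f\le Cg+D$ on $G$. A function $f:G\to\mathbb{R}$ is an estimate of the metric of $G$ if $f\sim\lVert\cdot\rVert_G$. $A\wr B=\left(\bigoplus_{b\in B}A_b\right)\rtimes B$ is the restricted regular wreath product, where $B$ acts on finitely supported maps $B\to A$ by changing the index via left multiplication on itself. $A$ is identified with the copy of $A$ at the index $e=1_B$, so that $bab^{-1}$ is the map with value $a$ at $b$ and trivial elsewhere. The group $A\wr B$ is generated by the union of finite generating sets of $A$ and $B$. Every $x\in A\wr B$ has a normal form $x=\left(\prod_{i=1}^s b_i a_i b_i^{-1}\right)b_f$, unique up to permuting the factors, where $b_1,\dots,b_s\in B$ are the distinct elements of the support of $x$, $a_i\in A\setminus\{1\}$ is the value at $b_i$, and $b_f\in B$. $\tau(e,b_i,b_f)$ is the length of a shortest path in the Cayley graph of $B$ (with $b$ adjacent to $bt$ for generators $t$, so that the distance is $d_B(b,b')=\lVert b^{-1}b'\rVert_B$) that starts at $e$, visits all of $b_1,\dots,b_s$ in any order, and ends at $b_f$. $\mu(e,b_i,b_f)$ is the total weight of a minimum spanning tree of the complete graph with vertices $e,b_1,\dots,b_s,b_f$ and edge weights $d_B(b,b')=\lVert b^{-1}b'\rVert_B$. $\hat\mu(e,b_i,b_f)$ is the weight of a minimum spanning tree of the same complete graph with edge weights $E_B(b^{-1}b')$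 in place of $\lVert b^{-1}b'\rVert_B$ (if $E_B(b^{-1}b')\ne E_B(b'^{-1}b)$, one of the two values is chosen for the unordered pair $\{b,b'\}$).
   Formalization: Items 2, 3 assume E_A ≥ 0 off the identity; item 4 assumes E_B ≥ 0 off it; items 5, 7 assume both ≥ 0 and at least one > 0 off it. Without this they fail for A=Z/2, B=Z: E_A=-100 (2, 3); E_B(m)=|m|-100 (4); E_A=0, E_B(m)=max(0,|m|-1) (5, 7). *)

theory Defs
  imports "HOL-Algebra.Product_Groups" Complex_Main
begin

section \<open>Word metrics and estimates\<close>

definition fin_generating :: "('a, 'm) monoid_scheme \<Rightarrow> 'a set \<Rightarrow> bool" where
  "fin_generating G S \<longleftrightarrow> finite S \<and> S \<subseteq> carrier G \<and> generate G S = carrier G"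

definition is_word :: "('a, 'm) monoid_scheme \<Rightarrow> 'a set \<Rightarrow> 'a list \<Rightarrow> 'a \<Rightarrow> bool" where
  "is_word G S ws g \<longleftrightarrow>
     set ws \<subseteq> S \<union> (\<lambda>s. inv\<^bsub>G\<^esub> s) ` S \<and> foldr (\<lambda>s h. s \<otimes>\<^bsub>G\<^esub> h) ws \<one>\<^bsub>G\<^esub> = g"

definition word_length :: "('a, 'm) monoid_scheme \<Rightarrow> 'a set \<Rightarrow> 'a \<Rightarrow> nat" where
  "word_length G S g = (LEAST n. \<exists>ws. length ws = n \<and> is_word G S ws g)"

definition equivalent_on :: "'x set \<Rightarrow> ('x \<Rightarrow> real) \<Rightarrow> ('x \<Rightarrow> real) \<Rightarrow> bool" where
  "equivalent_on U f g \<longleftrightarrow>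
     (\<exists>C D :: real. C > 0 \<and> D \<ge> 0 \<and> (\<forall>x\<in>U. g x / C - D \<le> f x \<and> f x \<le> C * g x + D))"

definition metric_estimate :: "('a, 'm) monoid_scheme \<Rightarrow> 'a set \<Rightarrow> ('a \<Rightarrow> real) \<Rightarrow> bool" where
  "metric_estimate G S E \<longleftrightarrow>
     equivalent_on (carrier G) E (\<lambda>g. real (word_length G S g))"

text \<open>
  An estimate may vanish or be negative on nontrivial elements, because of the additive constant
  \<open>D\<close>; summed over the support of an element of the wreath product, these errors are unbounded.
  With \<open>A = \<int>/2\<close> and \<open>B = \<int>\<close>, the functions \<open>E\<^sub>A = 0\<close> and \<open>E\<^sub>B(n) = max 0 (\<bar>n\<bar> - 1)\<close> are
  estimates. Let \<open>x\<close> have \<open>b\<^sub>f = 0\<close> and support \<open>{0..n}\<close>: the sum of the \<open>E\<^sub>A(a\<^sub>i)\<close> and the weight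
  of a minimum spanning tree for \<open>E\<^sub>B\<close> are both \<open>0\<close>, but \<open>x\<close> has word length at least \<open>n + 1\<close>.
  The following conditions exclude this behaviour.
\<close>

definition nonneg_off_one :: "('a, 'm) monoid_scheme \<Rightarrow> ('a \<Rightarrow> real) \<Rightarrow> bool" where
  "nonneg_off_one G E \<longleftrightarrow> (\<forall>g\<in>carrier G - {\<one>\<^bsub>G\<^esub>}. E g \<ge> 0)"

definition pos_off_one :: "('a, 'm) monoid_scheme \<Rightarrow> ('a \<Rightarrow> real) \<Rightarrow> bool" where
  "pos_off_one G E \<longleftrightarrow> (\<forall>g\<in>carrier G - {\<one>\<^bsub>G\<^esub>}. E g > 0)"


section \<open>The restricted regular wreath product\<close>

text \<open>An element is a pair \<open>(f, b\<^sub>f)\<close> of a finitely supported map \<open>f\<close> from \<open>B\<close> to \<open>A\<close>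
  (extensional outside \<open>carrier B\<close>, as in \<open>sum_group\<close>) and the cursor \<open>b\<^sub>f\<close>.\<close>

definition shift :: "('b, 'n) monoid_scheme \<Rightarrow> 'b \<Rightarrow> ('b \<Rightarrow> 'a) \<Rightarrow> 'b \<Rightarrow> 'a" where
  "shift B b f = (\<lambda>x\<in>carrier B. f (inv\<^bsub>B\<^esub> b \<otimes>\<^bsub>B\<^esub> x))"

definition wreath ::
  "('a, 'm) monoid_scheme \<Rightarrow> ('b, 'n) monoid_scheme \<Rightarrow> (('b \<Rightarrow> 'a) \<times> 'b) monoid" where
  "wreath A B =
     \<lparr>carrier = carrier (sum_group (carrier B) (\<lambda>_. A)) \<times> carrier B,
      monoid.mult = (\<lambda>(f, b) (g, c).
        (f \<otimes>\<^bsub>sum_group (carrier B) (\<lambda>_. A)\<^esub> shift B b g, b \<otimes>\<^bsub>B\<^esub> c)),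
      one = (\<one>\<^bsub>sum_group (carrier B) (\<lambda>_. A)\<^esub>, \<one>\<^bsub>B\<^esub>)\<rparr>"

definition single :: "('a, 'm) monoid_scheme \<Rightarrow> ('b, 'n) monoid_scheme \<Rightarrow> 'b \<Rightarrow> 'a \<Rightarrow> 'b \<Rightarrow> 'a" where
  "single A B b a = (\<lambda>x\<in>carrier B. if x = b then a else \<one>\<^bsub>A\<^esub>)"

definition embed_base ::
  "('a, 'm) monoid_scheme \<Rightarrow> ('b, 'n) monoid_scheme \<Rightarrow> 'a \<Rightarrow> ('b \<Rightarrow> 'a) \<times> 'b" where
  "embed_base A B a = (single A B \<one>\<^bsub>B\<^esub> a, \<one>\<^bsub>B\<^esub>)"

definition embed_top ::
  "('a, 'm) monoid_scheme \<Rightarrow> ('b, 'n) monoid_scheme \<Rightarrow> 'b \<Rightarrow> ('b \<Rightarrow> 'a) \<times> 'b" where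
  "embed_top A B b = (\<one>\<^bsub>sum_group (carrier B) (\<lambda>_. A)\<^esub>, b)"

definition wreath_gens ::
  "('a, 'm) monoid_scheme \<Rightarrow> ('b, 'n) monoid_scheme \<Rightarrow> 'a set \<Rightarrow> 'b set \<Rightarrow> (('b \<Rightarrow> 'a) \<times> 'b) set" where
  "wreath_gens A B S T = embed_base A B ` S \<union> embed_top A B ` T"

text \<open>In the normal form \<open>x = (\<Prod>i. b\<^sub>i a\<^sub>i b\<^sub>i\<inverse>) b\<^sub>f\<close>, the set of the \<open>b\<^sub>i\<close> is \<open>supp A B x\<close>, the
  value \<open>a\<^sub>i\<close> is \<open>fst x b\<^sub>i\<close>, and \<open>b\<^sub>f\<close> is \<open>snd x\<close>; see \<open>wreath_conj\<close> below for the factors.\<close>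

definition supp ::
  "('a, 'm) monoid_scheme \<Rightarrow> ('b, 'n) monoid_scheme \<Rightarrow> ('b \<Rightarrow> 'a) \<times> 'b \<Rightarrow> 'b set" where
  "supp A B x = {b \<in> carrier B. fst x b \<noteq> \<one>\<^bsub>A\<^esub>}"

definition value_sum ::
  "('a, 'm) monoid_scheme \<Rightarrow> ('b, 'n) monoid_scheme \<Rightarrow> ('a \<Rightarrow> real) \<Rightarrow> ('b \<Rightarrow> 'a) \<times> 'b \<Rightarrow> real" where
  "value_sum A B F x = (\<Sum>b\<in>supp A B x. F (fst x b))"


section \<open>Travelling salesman paths in the Cayley graph\<close>

definition cayley_adj :: "('b, 'n) monoid_scheme \<Rightarrow> 'b set \<Rightarrow> 'b \<Rightarrow> 'b \<Rightarrow> bool" where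
  "cayley_adj B T b c \<longleftrightarrow> b \<in> carrier B \<and> c \<in> carrier B \<and>
     (\<exists>t\<in>T. c = b \<otimes>\<^bsub>B\<^esub> t \<or> b = c \<otimes>\<^bsub>B\<^esub> t)"

text \<open>A path is given by its list of vertices, so \<open>n\<close> edges correspond to \<open>n + 1\<close> entries.\<close>

definition tsp_length :: "('b, 'n) monoid_scheme \<Rightarrow> 'b set \<Rightarrow> 'b \<Rightarrow> 'b set \<Rightarrow> 'b \<Rightarrow> nat" where
  "tsp_length B T u V v =
     (LEAST n. \<exists>p. length p = Suc n \<and> successively (cayley_adj B T) p \<and>
        hd p = u \<and> last p = v \<and> V \<subseteq> set p)"

definition tau ::
  "('a, 'm) monoid_scheme \<Rightarrow> ('b, 'n) monoid_scheme \<Rightarrow> 'b set \<Rightarrow> ('b \<Rightarrow> 'a) \<times> 'b \<Rightarrow> real" where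
  "tau A B T x = real (tsp_length B T \<one>\<^bsub>B\<^esub> (supp A B x) (snd x))"


section \<open>Minimum spanning trees\<close>

text \<open>Undirected simple graphs, given by a vertex set and a set of two-element edges.\<close>

definition complete_edges :: "'v set \<Rightarrow> 'v set set" where
  "complete_edges V = {{u, v} | u v. u \<in> V \<and> v \<in> V \<and> u \<noteq> v}"

definition connected_graph :: "'v set \<Rightarrow> 'v set set \<Rightarrow> bool" where
  "connected_graph V F \<longleftrightarrow> (\<forall>u\<in>V. \<forall>v\<in>V. (u, v) \<in> {(x, y). {x, y} \<in> F}\<^sup>*)"

definition acyclic_graph :: "'v set set \<Rightarrow> bool" where
  "acyclic_graph F \<longleftrightarrow>
     \<not> (\<exists>c. length c \<ge> 3 \<and> distinct c \<and> successively (\<lambda>x y. {x, y} \<in> F) c \<and> {last c, hd c} \<in> F)"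

definition spanning_tree_on :: "'v set \<Rightarrow> 'v set set \<Rightarrow> bool" where
  "spanning_tree_on V F \<longleftrightarrow> F \<subseteq> complete_edges V \<and> connected_graph V F \<and> acyclic_graph F"

definition mst_weight :: "'v set \<Rightarrow> ('v set \<Rightarrow> real) \<Rightarrow> real" where
  "mst_weight V w = Min ((\<lambda>F. \<Sum>e\<in>F. w e) ` {F. spanning_tree_on V F})"

definition tree_vertices ::
  "('a, 'm) monoid_scheme \<Rightarrow> ('b, 'n) monoid_scheme \<Rightarrow> ('b \<Rightarrow> 'a) \<times> 'b \<Rightarrow> 'b set" where
  "tree_vertices A B x = {\<one>\<^bsub>B\<^esub>, snd x} \<union> supp A B x"

text \<open>\<open>w\<close> selects, for every unordered pair of distinct elements, one of the two values that
  \<open>E\<close> assigns to it.\<close>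

definition pair_weight :: "('b, 'n) monoid_scheme \<Rightarrow> ('b \<Rightarrow> real) \<Rightarrow> ('b set \<Rightarrow> real) \<Rightarrow> bool" where
  "pair_weight B E w \<longleftrightarrow> (\<forall>b\<in>carrier B. \<forall>c\<in>carrier B. b \<noteq> c \<longrightarrow>
     w {b, c} = E (inv\<^bsub>B\<^esub> b \<otimes>\<^bsub>B\<^esub> c) \<or> w {b, c} = E (inv\<^bsub>B\<^esub> c \<otimes>\<^bsub>B\<^esub> b))"

text \<open>The description is unambiguous since the word metric is symmetric; see
  \<open>dist_weight_pair\<close> below.\<close>

definition dist_weight :: "('b, 'n) monoid_scheme \<Rightarrow> 'b set \<Rightarrow> 'b set \<Rightarrow> real" where
  "dist_weight B T e = (THE d. \<exists>b\<in>carrier B. \<exists>c\<in>carrier B.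
     e = {b, c} \<and> d = real (word_length B T (inv\<^bsub>B\<^esub> b \<otimes>\<^bsub>B\<^esub> c)))"

definition mu ::
  "('a, 'm) monoid_scheme \<Rightarrow> ('b, 'n) monoid_scheme \<Rightarrow> 'b set \<Rightarrow> ('b \<Rightarrow> 'a) \<times> 'b \<Rightarrow> real" where
  "mu A B T x = mst_weight (tree_vertices A B x) (dist_weight B T)"

definition mu_hat ::
  "('a, 'm) monoid_scheme \<Rightarrow> ('b, 'n) monoid_scheme \<Rightarrow> ('b set \<Rightarrow> real) \<Rightarrow> ('b \<Rightarrow> 'a) \<times> 'b \<Rightarrow> real" where
  "mu_hat A B w x = mst_weight (tree_vertices A B x) w"


section \<open>The definitions behave as intended\<close>

lemma carrier_wreath:
  assumes "group A"
  shows "carrier (wreath A B) =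
    {f \<in> carrier B \<rightarrow>\<^sub>E carrier A. finite {b \<in> carrier B. f b \<noteq> \<one>\<^bsub>A\<^esub>}} \<times> carrier B"
  using assms by (simp add: wreath_def carrier_sum_group)

lemma shift_closed:
  assumes "group A" "group B" "b \<in> carrier B" "f \<in> carrier (sum_group (carrier B) (\<lambda>_. A))"
  shows "shift B b f \<in> carrier (sum_group (carrier B) (\<lambda>_. A))"
proof -
  interpret A: group A by fact
  interpret B: group B by fact
  have "{x \<in> carrier B. f (inv\<^bsub>B\<^esub> b \<otimes>\<^bsub>B\<^esub> x) \<noteq> \<one>\<^bsub>A\<^esub>} \<subseteq>
      (\<lambda>y. b \<otimes>\<^bsub>B\<^esub> y) ` {y \<in> carrier B. f y \<noteq> \<one>\<^bsub>A\<^esub>}"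
  proof
    fix x assume x: "x \<in> {x \<in> carrier B. f (inv\<^bsub>B\<^esub> b \<otimes>\<^bsub>B\<^esub> x) \<noteq> \<one>\<^bsub>A\<^esub>}"
    then have "x = b \<otimes>\<^bsub>B\<^esub> (inv\<^bsub>B\<^esub> b \<otimes>\<^bsub>B\<^esub> x)"
      using assms(3) by (simp add: B.m_assoc[symmetric])
    then show "x \<in> (\<lambda>y. b \<otimes>\<^bsub>B\<^esub> y) ` {y \<in> carrier B. f y \<noteq> \<one>\<^bsub>A\<^esub>}"
      using x assms(3) by blast
  qed
  then have "finite {x \<in> carrier B. f (inv\<^bsub>B\<^esub> b \<otimes>\<^bsub>B\<^esub> x) \<noteq> \<one>\<^bsub>A\<^esub>}"
    using assms(1,4) by (auto simp: carrier_sum_group intro: finite_subset)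
  then show ?thesis
    using assms by (auto simp: carrier_sum_group shift_def PiE_iff cong: conj_cong)
qed

lemma group_wreath:
  assumes "group A" "group B"
  shows "group (wreath A B)"
proof -
  interpret A: group A by fact
  interpret B: group B by fact
  let ?S = "sum_group (carrier B) (\<lambda>_. A)"
  interpret S: group ?S using assms(1) by simp
  have inA: "f y \<in> carrier A" if "f \<in> carrier ?S" "y \<in> carrier B" for f y
    using that assms(1) by (auto simp: carrier_sum_group PiE_iff)
  have ext: "f \<in> extensional (carrier B)" if "f \<in> carrier ?S" for f
    using that assms(1) by (auto simp: carrier_sum_group PiE_iff)
  show ?thesis
  proof (rule groupI)
    fix x y assume "x \<in> carrier (wreath A B)" "y \<in> carrier (wreath A B)"
    then show "x \<otimes>\<^bsub>wreath A B\<^esub> y \<in> carrier (wreath A B)"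
      using shift_closed[OF assms] S.m_closed
      by (auto simp: wreath_def simp del: mult_sum_group)
  next
    show "\<one>\<^bsub>wreath A B\<^esub> \<in> carrier (wreath A B)"
      using S.one_closed by (auto simp: wreath_def simp del: one_sum_group)
  next
    fix x y z
    assume "x \<in> carrier (wreath A B)" "y \<in> carrier (wreath A B)" "z \<in> carrier (wreath A B)"
    then show "x \<otimes>\<^bsub>wreath A B\<^esub> y \<otimes>\<^bsub>wreath A B\<^esub> z = x \<otimes>\<^bsub>wreath A B\<^esub> (y \<otimes>\<^bsub>wreath A B\<^esub> z)"
      by (auto simp: wreath_def shift_def inA A.m_assoc B.m_assoc B.inv_mult_group
          intro!: restrict_ext)
  next
    fix x assume "x \<in> carrier (wreath A B)"
    then show "\<one>\<^bsub>wreath A B\<^esub> \<otimes>\<^bsub>wreath A B\<^esub> x = x"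
      by (auto simp: wreath_def shift_def inA intro!: extensionalityI[OF restrict_extensional ext])
  next
    fix x assume "x \<in> carrier (wreath A B)"
    then obtain f b where x: "x = (f, b)" "f \<in> carrier ?S" "b \<in> carrier B"
      by (auto simp: wreath_def)
    let ?g = "shift B (inv\<^bsub>B\<^esub> b) f"
    have g: "?g \<in> carrier ?S" by (rule shift_closed[OF assms]) (use x in auto)
    have "(inv\<^bsub>?S\<^esub> ?g, inv\<^bsub>B\<^esub> b) \<otimes>\<^bsub>wreath A B\<^esub> x = (inv\<^bsub>?S\<^esub> ?g \<otimes>\<^bsub>?S\<^esub> ?g, \<one>\<^bsub>B\<^esub>)"
      using x by (simp add: wreath_def)
    also have "\<dots> = \<one>\<^bsub>wreath A B\<^esub>"
      using S.l_inv[OF g] by (simp add: wreath_def)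
    finally show "\<exists>y\<in>carrier (wreath A B). y \<otimes>\<^bsub>wreath A B\<^esub> x = \<one>\<^bsub>wreath A B\<^esub>"
      using g x by (intro bexI[of _ "(inv\<^bsub>?S\<^esub> ?g, inv\<^bsub>B\<^esub> b)"])
        (auto simp: wreath_def simp del: inv_sum_group)
  qed
qed

lemma wreath_conj:
  assumes "group A" "group B" "a \<in> carrier A" "b \<in> carrier B"
  shows "embed_top A B b \<otimes>\<^bsub>wreath A B\<^esub> embed_base A B a \<otimes>\<^bsub>wreath A B\<^esub> embed_top A B (inv\<^bsub>B\<^esub> b)
    = (single A B b a, \<one>\<^bsub>B\<^esub>)"
proof -
  interpret A: group A by fact
  interpret B: group B by fact
  have "inv\<^bsub>B\<^esub> b \<otimes>\<^bsub>B\<^esub> x = \<one>\<^bsub>B\<^esub> \<longleftrightarrow> x = b" if "x \<in> carrier B" for x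
    using that assms(4) by (metis B.inv_closed B.inv_equality B.inv_inv B.l_inv)
  then show ?thesis
    using assms by (auto simp: wreath_def embed_top_def embed_base_def single_def shift_def
        intro!: restrict_ext)
qed

lemma foldr_mult_append:
  assumes "group G" "set xs \<subseteq> carrier G" "g \<in> carrier G" "h \<in> carrier G"
  shows "foldr (\<lambda>s h. s \<otimes>\<^bsub>G\<^esub> h) xs (g \<otimes>\<^bsub>G\<^esub> h) = foldr (\<lambda>s h. s \<otimes>\<^bsub>G\<^esub> h) xs g \<otimes>\<^bsub>G\<^esub> h
    \<and> foldr (\<lambda>s h. s \<otimes>\<^bsub>G\<^esub> h) xs g \<in> carrier G"
proof -
  interpret group G by fact
  show ?thesis using assms(2) by (induction xs) (use assms in \<open>auto simp: m_assoc\<close>)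
qed

lemma is_word_inv:
  assumes "group G" "S \<subseteq> carrier G" "is_word G S ws g"
  shows "is_word G S (rev (map (\<lambda>s. inv\<^bsub>G\<^esub> s) ws)) (inv\<^bsub>G\<^esub> g)"
proof -
  interpret group G by fact
  let ?f = "foldr (\<lambda>s h. s \<otimes>\<^bsub>G\<^esub> h)" and ?i = "\<lambda>ws. rev (map (\<lambda>s. inv\<^bsub>G\<^esub> s) ws)"
  have sub: "set ws \<subseteq> S \<union> (\<lambda>s. inv\<^bsub>G\<^esub> s) ` S" and g: "?f ws \<one>\<^bsub>G\<^esub> = g"
    using assms(3) by (auto simp: is_word_def)
  have wc: "set ws \<subseteq> carrier G" using sub assms(2) by auto
  have eq: "?f (?i ws) \<one>\<^bsub>G\<^esub> = inv\<^bsub>G\<^esub> (?f ws \<one>\<^bsub>G\<^esub>)"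
    using wc
  proof (induction ws)
    case (Cons a ws)
    have c: "?f ws \<one>\<^bsub>G\<^esub> \<in> carrier G"
      using foldr_mult_append[OF assms(1), of ws "\<one>\<^bsub>G\<^esub>" "\<one>\<^bsub>G\<^esub>"] Cons.prems by auto
    have "?f (?i (a # ws)) \<one>\<^bsub>G\<^esub> = ?f (?i ws) (\<one>\<^bsub>G\<^esub> \<otimes>\<^bsub>G\<^esub> inv\<^bsub>G\<^esub> a)"
      using Cons.prems by simp
    also have "\<dots> = ?f (?i ws) \<one>\<^bsub>G\<^esub> \<otimes>\<^bsub>G\<^esub> inv\<^bsub>G\<^esub> a"
      using foldr_mult_append[OF assms(1), of "?i ws" "\<one>\<^bsub>G\<^esub>" "inv\<^bsub>G\<^esub> a"] Cons.prems by auto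
    also have "\<dots> = inv\<^bsub>G\<^esub> (?f (a # ws) \<one>\<^bsub>G\<^esub>)"
      using Cons c by (simp add: inv_mult_group)
    finally show ?case .
  qed simp
  have "(\<lambda>s. inv\<^bsub>G\<^esub> s) ` set ws \<subseteq> S \<union> (\<lambda>s. inv\<^bsub>G\<^esub> s) ` S"
  proof
    fix y assume "y \<in> (\<lambda>s. inv\<^bsub>G\<^esub> s) ` set ws"
    then obtain s where "y = inv\<^bsub>G\<^esub> s" "s \<in> set ws" by blast
    moreover from this have "s \<in> S \<or> (\<exists>t\<in>S. s = inv\<^bsub>G\<^esub> t)" using sub by blast
    ultimately
    show "y \<in> S \<union> (\<lambda>s. inv\<^bsub>G\<^esub> s) ` S"
      using assms(2) by (metis UnCI image_eqI inv_inv subsetD)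
  qed
  then show ?thesis using eq g by (simp add: is_word_def)
qed

lemma word_length_inv:
  assumes "group G" "S \<subseteq> carrier G" "g \<in> carrier G"
  shows "word_length G S (inv\<^bsub>G\<^esub> g) = word_length G S g"
proof -
  have "(\<exists>ws. length ws = n \<and> is_word G S ws (inv\<^bsub>G\<^esub> g)) \<longleftrightarrow>
      (\<exists>ws. length ws = n \<and> is_word G S ws g)" for n
    using is_word_inv[OF assms(1,2)] group.inv_inv[OF assms(1,3)]
    by (metis length_map length_rev)
  then show ?thesis by (simp add: word_length_def)
qed

lemma dist_weight_pair:
  assumes "group B" "T \<subseteq> carrier B" "b \<in> carrier B" "c \<in> carrier B"
  shows "dist_weight B T {b, c} = real (word_length B T (inv\<^bsub>B\<^esub> b \<otimes>\<^bsub>B\<^esub> c))"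
proof -
  interpret group B by fact
  have "inv\<^bsub>B\<^esub> (inv\<^bsub>B\<^esub> b \<otimes>\<^bsub>B\<^esub> c) = inv\<^bsub>B\<^esub> c \<otimes>\<^bsub>B\<^esub> b"
    using assms by (simp add: inv_mult_group)
  then have "word_length B T (inv\<^bsub>B\<^esub> c \<otimes>\<^bsub>B\<^esub> b) = word_length B T (inv\<^bsub>B\<^esub> b \<otimes>\<^bsub>B\<^esub> c)"
    using word_length_inv[OF assms(1,2), of "inv\<^bsub>B\<^esub> b \<otimes>\<^bsub>B\<^esub> c"] assms by simp
  then show ?thesis
    unfolding dist_weight_def using assms
    by (intro the_equality) (auto simp: doubleton_eq_iff)
qed

end

theory Submission
  imports Defs
begin

text \<open>
  The proof rests on one exact formula. A word for \<open>x = (f, b\<^sub>f)\<close> in the generators of the wreath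
  product is an itinerary of a cursor in the Cayley graph of \<open>B\<close>: a letter of \<open>B\<close> moves the cursor
  along an edge, and a letter of \<open>A\<close> multiplies the value at the cursor. To produce \<open>x\<close>, the cursor has
  to go from \<open>1\<close> to \<open>b\<^sub>f\<close> through the whole support, and the value \<open>a\<^sub>i\<close> costs at least, and
  with an optimal word exactly, its word length in \<open>A\<close>. Hence \<open>\<parallel>x\<parallel> = \<Sum> \<parallel>a\<^sub>i\<parallel> + \<tau>\<close>
  (\<open>word_length_wreath\<close>).

  The travelling salesman length is then exchanged for the spanning tree. Walking around a spanning
  tree of weight \<open>m\<close> gives a closed tour of length \<open>2 m\<close>; running it once and then again up to a
  visit to \<open>b\<^sub>f\<close> gives \<open>\<tau> \<le> 4 \<mu>\<close> (\<open>tsp_length_le_mst\<close>; the constant is not optimal). Conversely,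
  joining consecutive visited vertices along an optimal path gives a connected graph of
  weight at most \<open>\<tau>\<close>, so \<open>\<mu> \<le> \<tau>\<close> (\<open>mst_le_tsp_length\<close>).

  Finally, the metrics of \<open>A\<close> and \<open>B\<close> are exchanged for estimates. The multiplicative constants of
  an estimate pass through sums, but its additive constant \<open>D\<close> is incurred once for every point of
  the support, or once for every edge of the tree. Upper bounds are harmless: a nontrivial element has
  length at least \<open>1\<close>, so \<open>C \<parallel>g\<parallel> + D \<le> (C + D) \<parallel>g\<parallel>\<close>. For lower bounds the number \<open>s\<close> of support points
  has to be controlled by a part of the expression that still uses a true metric: \<open>s \<le> \<tau> + 1 \<le> 4 \<mu> + 1\<close>,
  as a path visits its vertices one at a time, or \<open>s \<le> \<Sum> \<parallel>a\<^sub>i\<parallel>\<close>, as the values are nontrivial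
  (the tree has at most \<open>s + 1\<close> edges); nonnegativity off the identity keeps the remaining summands
  from cancelling this part. When both metrics are replaced, no such part is left;
  but if one of the two estimates is positive off the identity, finiteness of balls bounds it below by
  a multiple of the metric without an additive error (\<open>positive_estimate_lower\<close>), so that this
  metric may be put back first. Adding \<open>E\<^sub>B(b\<^sub>f)\<close> changes nothing up to equivalence, because
  \<open>\<parallel>b\<^sub>f\<parallel> \<le> \<tau>\<close> and \<open>E\<^sub>B\<close> is bounded below.
\<close>

section \<open>Connected graphs and minimum spanning trees\<close>

lemma sym_graph_rel: "(x, y) \<in> {(x, y). {x, y} \<in> F}\<^sup>* \<Longrightarrow> (y, x) \<in> {(x, y). {x, y} \<in> F}\<^sup>*"
  by (rule symD[OF sym_rtrancl]) (auto simp: sym_def insert_commute)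

lemma finite_complete_edges: "finite V \<Longrightarrow> finite (complete_edges V)"
  by (rule finite_subset[of _ "Pow V"]) (auto simp: complete_edges_def)

lemma complete_edges_mono: "W \<subseteq> V \<Longrightarrow> complete_edges W \<subseteq> complete_edges V"
  unfolding complete_edges_def by blast

lemma connected_complete: "connected_graph V (complete_edges V)"
  unfolding connected_graph_def
proof (intro ballI)
  fix u v assume "u \<in> V" "v \<in> V"
  then have "u = v \<or> {u, v} \<in> complete_edges V"
    unfolding complete_edges_def by blast
  then show "(u, v) \<in> {(x, y). {x, y} \<in> complete_edges V}\<^sup>*" by auto
qed

lemma connected_graph_mono:
  assumes "connected_graph V F" "F \<subseteq> F'"
  shows "connected_graph V F'"
proof -
  have "{(x, y). {x, y} \<in> F}\<^sup>* \<subseteq> {(x, y). {x, y} \<in> F'}\<^sup>*"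
    using assms(2) by (intro rtrancl_mono) auto
  then show ?thesis using assms(1) unfolding connected_graph_def by blast
qed

lemma connected_graph_insert:
  assumes "connected_graph V F" "x \<in> V"
  shows "connected_graph (insert y V) (insert {x, y} F)"
proof -
  let ?R = "{(u, v). {u, v} \<in> insert {x, y} F}\<^sup>*"
  have c: "connected_graph V (insert {x, y} F)"
    by (rule connected_graph_mono[OF assms(1)]) auto
  have to_x: "(u, x) \<in> ?R" if "u \<in> insert y V" for u
  proof (cases "u \<in> V")
    case True
    then show ?thesis using c assms(2) unfolding connected_graph_def by blast
  next
    case False
    then have "u = y" using that by blast
    then show ?thesis by (intro r_into_rtrancl) (simp add: insert_commute)
  qed
  show ?thesis unfolding connected_graph_def
  proof (intro ballI)
    fix u v assume "u \<in> insert y V" "v \<in> insert y V"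
    then show "(u, v) \<in> ?R" by (rule rtrancl_trans[OF to_x sym_graph_rel[OF to_x]])
  qed
qed

lemma connected_graph_crossing_edge:
  assumes "connected_graph V F" "F \<subseteq> complete_edges V" "u \<in> W" "W \<subset> V"
  obtains x y where "x \<in> W" "y \<in> V - W" "{x, y} \<in> F"
proof -
  obtain v where v: "v \<in> V" "v \<notin> W" using assms(4) by blast
  have "(u, v) \<in> {(x, y). {x, y} \<in> F}\<^sup>*"
    using assms v unfolding connected_graph_def by blast
  then have "\<exists>x y. x \<in> W \<and> y \<notin> W \<and> {x, y} \<in> F"
    using v(2) assms(3)
  proof (induction rule: rtrancl_induct)
    case base then show ?case by simp
  next
    case (step y z)
    then show ?case by (cases "y \<in> W") auto
  qed
  then obtain x y where xy: "x \<in> W" "y \<notin> W" "{x, y} \<in> F" by blast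
  moreover have "y \<in> V" using xy(3) assms(2) unfolding complete_edges_def
    by (auto simp: doubleton_eq_iff)
  ultimately show thesis using that by blast
qed

text \<open>
  Induction along a connected graph: starting from \<open>{u}\<close>, all of \<open>V\<close> is reached by
  attaching one new vertex at a time by one edge. The edges used form the subgraph \<open>G\<close>; in this form
  the rule bounds the number of edges of a tree as well as the length of a tour around it.
\<close>
lemma connected_graph_growth:
  assumes V: "finite V" "connected_graph V F" "F \<subseteq> complete_edges V" "u \<in> V"
    and start: "P {u} {}"
    and grow: "\<And>W G x y. P W G \<Longrightarrow> W \<subseteq> V \<Longrightarrow> G \<subseteq> F \<Longrightarrow> G \<subseteq> complete_edges W \<Longrightarrow>
      x \<in> W \<Longrightarrow> y \<in> V - W \<Longrightarrow> {x, y} \<in> F \<Longrightarrow> P (insert y W) (insert {x, y} G)"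
  shows "\<exists>G\<subseteq>F. P V G"
proof -
  have "\<exists>G'\<subseteq>F. P V G'"
    if "P W G" "u \<in> W" "W \<subseteq> V" "G \<subseteq> F" "G \<subseteq> complete_edges W" for W G
    using that
  proof (induction "card (V - W)" arbitrary: W G rule: less_induct)
    case less
    show ?case
    proof (cases "W = V")
      case True
      then show ?thesis using less.prems by blast
    next
      case False
      then have "W \<subset> V" using less.prems by blast
      then obtain x y where xy: "x \<in> W" "y \<in> V - W" "{x, y} \<in> F"
        using connected_graph_crossing_edge[OF V(2,3) \<open>u \<in> W\<close>] by blast
      have "{x, y} \<in> complete_edges (insert y W)"
        using xy unfolding complete_edges_def by blast
      then have G: "insert {x, y} G \<subseteq> complete_edges (insert y W)"
        using less.prems(5) complete_edges_mono[of W "insert y W"] by blast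
      have "card (V - insert y W) < card (V - W)"
        using xy V(1) by (intro psubset_card_mono) auto
      then show ?thesis
        using less.prems xy by (intro less.hyps[OF _ grow[OF less.prems(1,3,4,5) xy] _ _ _ G]) auto
    qed
  qed
  then show ?thesis using start V(4) by simp
qed

text \<open>
  The closing edge of a cycle is redundant, because the rest of the cycle joins its ends: a cycle has
  at least three distinct vertices, so none of its other edges coincides with the closing one.
\<close>
lemma connected_graph_remove_cycle_edge:
  assumes conn: "connected_graph V F" and c: "length c \<ge> 3" "distinct c"
    "successively (\<lambda>x y. {x, y} \<in> F) c"
  shows "connected_graph V (F - {{last c, hd c}})"
proof -
  let ?F = "F - {{last c, hd c}}"
  have ne: "{x, y} \<noteq> {last c, hd c}" if "xs @ x # y # ys = c" for xs x y ys
    using that c(1,2) by (cases xs; cases ys rule: rev_cases) (auto simp: doubleton_eq_iff)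
  have "successively (\<lambda>x y. {x, y} \<in> ?F) q" if "xs @ q = c" for q xs
    using that
  proof (induction q arbitrary: xs)
    case (Cons x q)
    then show ?case
    proof (cases q)
      case (Cons y ys)
      then have "{x, y} \<noteq> {last c, hd c}" using ne Cons.prems by blast
      moreover have "{x, y} \<in> F"
        using c(3) Cons.prems Cons by (auto simp: successively_append_iff)
      moreover have "successively (\<lambda>x y. {x, y} \<in> ?F) q"
        using Cons.IH[of "xs @ [x]"] Cons.prems by simp
      ultimately show ?thesis using Cons by simp
    qed simp
  qed simp
  then have s: "successively (\<lambda>x y. {x, y} \<in> ?F) c" by force
  have path: "(hd q, last q) \<in> {(x, y). {x, y} \<in> G}\<^sup>*"
    if "successively (\<lambda>x y. {x, y} \<in> G) q" "q \<noteq> []" for q and G :: "'a set set"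
    using that
  proof (induction q)
    case (Cons x q)
    then show ?case
      by (cases "q = []") (auto simp: successively_Cons intro: converse_rtrancl_into_rtrancl)
  qed simp
  have hl: "(hd c, last c) \<in> {(x, y). {x, y} \<in> ?F}\<^sup>*"
    using path[OF s] c(1) by (cases c) auto
  have "{(x, y). {x, y} \<in> F} \<subseteq> {(x, y). {x, y} \<in> ?F}\<^sup>*"
  proof clarify
    fix x y assume xy: "{x, y} \<in> F"
    show "(x, y) \<in> {(x, y). {x, y} \<in> ?F}\<^sup>*"
    proof (cases "{x, y} = {last c, hd c}")
      case True
      then show ?thesis using hl sym_graph_rel[OF hl] by (auto simp: doubleton_eq_iff)
    next
      case False
      then show ?thesis using xy by blast
    qed
  qed
  then have "{(x, y). {x, y} \<in> F}\<^sup>* \<subseteq> {(x, y). {x, y} \<in> ?F}\<^sup>*"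
    by (simp add: rtrancl_subset_rtrancl)
  then show ?thesis using conn unfolding connected_graph_def by blast
qed

text \<open>
  A connected subgraph that is minimal with respect to inclusion has no cycle, as a cycle edge could be removed.
\<close>
lemma connected_graph_contains_spanning_tree:
  assumes "finite V" "F \<subseteq> complete_edges V" "connected_graph V F"
  obtains G where "G \<subseteq> F" "spanning_tree_on V G"
proof -
  let ?S = "{G. G \<subseteq> F \<and> connected_graph V G}"
  have fF: "finite F" using finite_subset[OF assms(2) finite_complete_edges[OF assms(1)]] .
  then have "finite ?S" by (intro finite_subset[of ?S "Pow F"]) auto
  moreover have "F \<in> ?S" using assms by simp
  ultimately have "\<exists>G\<in>?S. \<forall>H\<in>?S. H \<subseteq> G \<longrightarrow> G = H"
    by (intro finite_has_minimal) auto
  then obtain G where G: "G \<in> ?S" "\<And>H. H \<in> ?S \<Longrightarrow> H \<subseteq> G \<Longrightarrow> H = G"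
    by metis
  have "acyclic_graph G" unfolding acyclic_graph_def
  proof
    assume "\<exists>c. length c \<ge> 3 \<and> distinct c \<and> successively (\<lambda>x y. {x, y} \<in> G) c \<and> {last c, hd c} \<in> G"
    then obtain c where c: "length c \<ge> 3" "distinct c" "successively (\<lambda>x y. {x, y} \<in> G) c"
      "{last c, hd c} \<in> G" by blast
    have "G - {{last c, hd c}} \<in> ?S"
      using connected_graph_remove_cycle_edge[OF _ c(1-3)] G(1) by blast
    then have "G - {{last c, hd c}} = G" using G(2) by simp
    then show False using c(4) by blast
  qed
  then have "spanning_tree_on V G" using G(1) assms(2) unfolding spanning_tree_on_def by blast
  then show thesis using G(1) that by blast
qed

lemma connected_graph_simple_path:
  assumes "(u, v) \<in> {(x, y). {x, y} \<in> F}\<^sup>*"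
  obtains c where "c \<noteq> []" "hd c = u" "last c = v" "distinct c" "successively (\<lambda>x y. {x, y} \<in> F) c"
proof -
  have "\<exists>c. c \<noteq> [] \<and> hd c = u \<and> last c = v \<and> distinct c \<and> successively (\<lambda>x y. {x, y} \<in> F) c"
    using assms
  proof (induction rule: rtrancl_induct)
    case base
    show ?case by (intro exI[of _ "[u]"]) simp
  next
    case (step y z)
    then obtain c where c: "c \<noteq> []" "hd c = u" "last c = y" "distinct c"
      "successively (\<lambda>x y. {x, y} \<in> F) c" by blast
    show ?case
    proof (cases "z \<in> set c")
      case True
      then obtain xs ys where "c = xs @ z # ys" by (meson split_list)
      then show ?thesis using c
        by (intro exI[of _ "xs @ [z]"]) (auto simp: successively_append_iff hd_append)
    next
      case False
      then show ?thesis using c step.hyps(2)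
        by (intro exI[of _ "c @ [z]"]) (auto simp: successively_append_iff)
    qed
  qed
  then show thesis using that by blast
qed

text \<open>
  Growing the tree vertex by vertex yields a connected subgraph with one edge less than vertices. An
  edge of the tree outside this subgraph would close a cycle with a simple path inside it, so
  the subgraph is the whole tree.
\<close>
lemma card_spanning_tree_le:
  assumes V: "finite V" "V \<noteq> {}" and F: "spanning_tree_on V F"
  shows "card F < card V"
proof -
  obtain u where u: "u \<in> V" using V by blast
  have F': "F \<subseteq> complete_edges V" "connected_graph V F" "acyclic_graph F"
    using F unfolding spanning_tree_on_def by auto
  have "\<exists>G\<subseteq>F. finite V \<and> finite G \<and> card G < card V \<and> connected_graph V G"
  proof (rule connected_graph_growth[where P = "\<lambda>W G. finite W \<and> finite G \<and> card G < card W \<and> connected_graph W G",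
        OF V(1) F'(2,1) u])
    fix W G x y
    assume a: "finite W \<and> finite G \<and> card G < card W \<and> connected_graph W G" "x \<in> W" "y \<in> V - W"
    then show "finite (insert y W) \<and> finite (insert {x, y} G) \<and>
        card (insert {x, y} G) < card (insert y W) \<and> connected_graph (insert y W) (insert {x, y} G)"
      using connected_graph_insert[of W G x y] by (auto simp: card_insert_if)
  qed (simp add: connected_graph_def)
  then obtain G where G: "G \<subseteq> F" "card G < card V" "connected_graph V G" by blast
  have "e \<in> G" if eF: "e \<in> F" for e
  proof (rule ccontr)
    assume "e \<notin> G"
    obtain a b where e: "e = {a, b}" "a \<in> V" "b \<in> V" "a \<noteq> b"
      using eF F'(1) unfolding complete_edges_def by blast
    then have "(a, b) \<in> {(x, y). {x, y} \<in> G}\<^sup>*" using G(3) unfolding connected_graph_def by blast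
    then obtain c where c: "c \<noteq> []" "hd c = a" "last c = b" "distinct c"
      "successively (\<lambda>x y. {x, y} \<in> G) c" by (rule connected_graph_simple_path)
    have "length c \<ge> 3"
    proof (rule ccontr)
      assume "\<not> ?thesis"
      then have "length c = 1 \<or> length c = 2" using c(1) length_greater_0_conv[of c] by linarith
      then have "c = [a] \<or> c = [a, b]" using c(1-3)
        by (auto simp: length_Suc_conv numeral_2_eq_2)
      then show False
      proof
        assume "c = [a]" then show False using c(3) e(4) by simp
      next
        assume eq: "c = [a, b]"
        have "{a, b} \<in> G" using c(5) unfolding eq by simp
        then show False using e(1) \<open>e \<notin> G\<close> by simp
      qed
    qed
    moreover have "successively (\<lambda>x y. {x, y} \<in> F) c"
      by (rule successively_mono[OF c(5)]) (use G(1) in auto)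
    moreover have "{last c, hd c} \<in> F" using c e eF by (simp add: insert_commute)
    ultimately show False using F'(3) c(4) unfolding acyclic_graph_def by blast
  qed
  then have "F = G" using G(1) by blast
  then show ?thesis using G by simp
qed

lemma finite_spanning_trees: "finite V \<Longrightarrow> finite {F. spanning_tree_on V F}"
  by (rule finite_subset[of _ "Pow (complete_edges V)"])
    (auto simp: spanning_tree_on_def finite_complete_edges)

lemma mst_weight_attained:
  assumes "finite V"
  obtains F where "spanning_tree_on V F" "mst_weight V w = (\<Sum>e\<in>F. w e)"
proof -
  obtain F where "spanning_tree_on V F"
    using connected_graph_contains_spanning_tree[OF assms order_refl connected_complete] .
  then have "mst_weight V w \<in> (\<lambda>F. \<Sum>e\<in>F. w e) ` {F. spanning_tree_on V F}"
    unfolding mst_weight_def using finite_spanning_trees[OF assms] by (intro Min_in) auto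
  then show thesis using that by blast
qed

lemma mst_weight_le_spanning_tree:
  assumes "finite V" "spanning_tree_on V F"
  shows "mst_weight V w \<le> (\<Sum>e\<in>F. w e)"
  unfolding mst_weight_def using finite_spanning_trees[OF assms(1)] assms(2)
  by (intro Min_le) auto

lemma mst_weight_le_connected:
  assumes V: "finite V" and F: "F \<subseteq> complete_edges V" "connected_graph V F"
    and w: "\<And>e. e \<in> complete_edges V \<Longrightarrow> 0 \<le> w e"
  shows "mst_weight V w \<le> (\<Sum>e\<in>F. w e)"
proof -
  obtain G where G: "G \<subseteq> F" "spanning_tree_on V G"
    using connected_graph_contains_spanning_tree[OF V F] .
  have "mst_weight V w \<le> (\<Sum>e\<in>G. w e)" by (rule mst_weight_le_spanning_tree[OF V G(2)])
  also have "\<dots> \<le> (\<Sum>e\<in>F. w e)"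
    using G(1) F(1) w finite_subset[OF F(1) finite_complete_edges[OF V]]
    by (intro sum_mono2) auto
  finally show ?thesis .
qed

lemma mst_weight_nonneg:
  assumes V: "finite V" and w: "\<And>e. e \<in> complete_edges V \<Longrightarrow> 0 \<le> w e"
  shows "0 \<le> mst_weight V w"
proof -
  obtain F where F: "spanning_tree_on V F" "mst_weight V w = (\<Sum>e\<in>F. w e)"
    using mst_weight_attained[OF V] .
  then show ?thesis using w unfolding spanning_tree_on_def by (auto intro!: sum_nonneg)
qed

text \<open>
  Comparing two weights on an optimal tree for one of them. The additive error is multiplied by the number
  of edges, which is where acyclicity of spanning trees enters quantitatively.
\<close>
lemma mst_weight_affine_le:
  assumes V: "finite V" "V \<noteq> {}" and CD: "0 \<le> C" "0 \<le> D"
    and le: "\<And>e. e \<in> complete_edges V \<Longrightarrow> w' e \<le> C * w e + D"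
  shows "mst_weight V w' \<le> C * mst_weight V w + D * real (card V)"
proof -
  obtain F where F: "spanning_tree_on V F" "mst_weight V w = (\<Sum>e\<in>F. w e)"
    using mst_weight_attained[OF V(1)] .
  have "mst_weight V w' \<le> (\<Sum>e\<in>F. w' e)" by (rule mst_weight_le_spanning_tree[OF V(1) F(1)])
  also have "\<dots> \<le> (\<Sum>e\<in>F. C * w e + D)"
    using le F(1) unfolding spanning_tree_on_def by (intro sum_mono) blast
  also have "\<dots> = C * mst_weight V w + D * real (card F)"
    using F(2) by (simp add: sum.distrib sum_distrib_left)
  also have "\<dots> \<le> C * mst_weight V w + D * real (card V)"
    using card_spanning_tree_le[OF V F(1)] CD by (intro add_left_mono mult_left_mono) auto
  finally show ?thesis .
qed

section \<open>Walks\<close>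

definition walk :: "('v \<Rightarrow> 'v \<Rightarrow> bool) \<Rightarrow> 'v \<Rightarrow> 'v list \<Rightarrow> 'v \<Rightarrow> bool" where
  "walk R u p v \<longleftrightarrow> p \<noteq> [] \<and> successively R p \<and> hd p = u \<and> last p = v"

lemma walk_singleton: "walk R u [u] u"
  by (simp add: walk_def)

lemma walk_snoc: "walk R u p v \<Longrightarrow> R v w \<Longrightarrow> walk R u (p @ [w]) w"
  by (simp add: walk_def successively_append_iff)

lemma walk_rev:
  assumes "walk R u p v" "\<And>x y. R x y \<Longrightarrow> R y x"
  shows "walk R v (rev p) u"
proof -
  have "successively R p" using assms(1) by (simp add: walk_def)
  then have "successively (\<lambda>x y. R y x) p" by (rule successively_mono) (rule assms(2))
  then show ?thesis using assms(1) by (simp add: walk_def hd_rev last_rev)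
qed

lemma walk_append:
  assumes "walk R u p v" "walk R v q w"
  shows "walk R u (p @ tl q) w"
    and "set (p @ tl q) = set p \<union> set q"
    and "length (p @ tl q) + 1 = length p + length q"
proof -
  obtain q' where q: "q = v # q'" using assms(2) by (cases q) (auto simp: walk_def)
  show "walk R u (p @ tl q) w"
    using assms unfolding q walk_def by (auto simp: successively_append_iff successively_Cons)
  show "set (p @ tl q) = set p \<union> set q" using assms(1) unfolding q walk_def by auto
  show "length (p @ tl q) + 1 = length p + length q" unfolding q by simp
qed

lemma walk_split:
  assumes "walk R u p v" "x \<in> set p"
  obtains q r where "walk R u q x" "walk R x r v" "p = q @ tl r"
proof -
  obtain xs ys where p: "p = xs @ x # ys" using assms(2) by (meson split_list)
  have "walk R u (xs @ [x]) x" "walk R x (x # ys) v"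
    using assms(1) unfolding p walk_def
    by (auto simp: successively_append_iff hd_append split: if_splits)
  then show thesis using that p by simp
qed


section \<open>Word length in a finitely generated group\<close>

context group
begin

lemma is_word_Nil: "is_word G S [] \<one>"
  by (simp add: is_word_def)

lemma letters_closed: "S \<subseteq> carrier G \<Longrightarrow> S \<union> (\<lambda>s. inv s) ` S \<subseteq> carrier G"
  by auto

lemma is_word_closed:
  assumes "S \<subseteq> carrier G" "is_word G S ws g"
  shows "g \<in> carrier G"
proof -
  have "set ws \<subseteq> carrier G" "foldr (\<lambda>s h. s \<otimes> h) ws \<one> = g"
    using assms(2) letters_closed[OF assms(1)] by (auto simp: is_word_def)
  then show ?thesis using foldr_mult_append[OF is_group, of ws \<one> \<one>] by simp
qed

lemma is_word_append:
  assumes "S \<subseteq> carrier G" "is_word G S xs g" "is_word G S ys h"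
  shows "is_word G S (xs @ ys) (g \<otimes> h)"
proof -
  have "set xs \<subseteq> carrier G" "foldr (\<lambda>s h. s \<otimes> h) xs \<one> = g"
    "foldr (\<lambda>s h. s \<otimes> h) ys \<one> = h"
    using assms(2,3) letters_closed[OF assms(1)] by (auto simp: is_word_def)
  then show ?thesis
    using foldr_mult_append[OF is_group, of xs \<one> h] is_word_closed[OF assms(1,3)] assms(2,3)
    by (simp add: is_word_def)
qed

lemma is_word_letter:
  assumes "S \<subseteq> carrier G" "s \<in> S \<union> (\<lambda>s. inv s) ` S"
  shows "is_word G S [s] s"
  using assms by (auto simp: is_word_def)

text \<open>
  Induction on words from the right, where a new letter acts by right multiplication: in a Cayley graph
  this is a step along an edge, and in the wreath product it is a change at the cursor.
\<close>
lemma is_word_snoc_induct [consumes 2, case_names Nil snoc]: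
  assumes S: "S \<subseteq> carrier G" and "is_word G S ws g"
    and nil: "P [] \<one>"
    and snoc: "\<And>ws g s. is_word G S ws g \<Longrightarrow> P ws g \<Longrightarrow> s \<in> S \<union> (\<lambda>s. inv s) ` S
      \<Longrightarrow> P (ws @ [s]) (g \<otimes> s)"
  shows "P ws g"
  using assms(2)
proof (induction ws arbitrary: g rule: rev_induct)
  case Nil
  then show ?case using nil by (simp add: is_word_def)
next
  case (snoc s ws)
  let ?g = "foldr (\<lambda>s h. s \<otimes> h) ws \<one>"
  have w: "is_word G S ws ?g" and s: "s \<in> S \<union> (\<lambda>s. inv s) ` S"
    using snoc.prems by (auto simp: is_word_def)
  have "is_word G S (ws @ [s]) (?g \<otimes> s)"
    by (rule is_word_append[OF S w is_word_letter[OF S s]])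
  then have "g = ?g \<otimes> s" using snoc.prems by (simp add: is_word_def)
  then show ?case using assms(4)[OF w snoc.IH[OF w] s] by simp
qed

end

lemma word_length_le: "is_word G S ws g \<Longrightarrow> word_length G S g \<le> length ws"
  unfolding word_length_def by (rule Least_le) blast

lemma word_length_attained:
  assumes "is_word G S ws' g"
  obtains ws where "is_word G S ws g" "length ws = word_length G S g"
proof -
  have "\<exists>n ws. length ws = n \<and> is_word G S ws g" using assms by blast
  then have "\<exists>ws. length ws = word_length G S g \<and> is_word G S ws g"
    unfolding word_length_def by (rule LeastI_ex)
  then show thesis using that by blast
qed

locale finitely_generated_group = group G for G (structure) +
  fixes S
  assumes fin_gen: "fin_generating G S"
begin

abbreviation wl where "wl \<equiv> word_length G S"

abbreviation letters where "letters \<equiv> S \<union> (\<lambda>s. inv s) ` S"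

lemma gens_closed: "S \<subseteq> carrier G"
  using fin_gen by (simp add: fin_generating_def)

lemma word_exists:
  assumes "g \<in> carrier G"
  shows "\<exists>ws. is_word G S ws g"
proof -
  have "g \<in> generate G S" using assms fin_gen by (simp add: fin_generating_def)
  then show ?thesis
  proof induction
    case one
    show ?case using is_word_Nil by blast
  next
    case (incl h)
    then show ?case using is_word_letter[OF gens_closed, of h] by blast
  next
    case (inv h)
    then show ?case using is_word_letter[OF gens_closed, of "inv h"] by blast
  next
    case (eng h1 h2)
    then show ?case using is_word_append[OF gens_closed] by blast
  qed
qed

lemma shortest_word:
  assumes "g \<in> carrier G"
  obtains ws where "is_word G S ws g" "length ws = wl g"
  using word_exists[OF assms] word_length_attained by metis

lemma wl_one [simp]: "wl \<one> = 0"
  using word_length_le[OF is_word_Nil, of S] by simp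

lemma wl_mult_le:
  assumes "g \<in> carrier G" "h \<in> carrier G"
  shows "wl (g \<otimes> h) \<le> wl g + wl h"
proof -
  obtain xs where xs: "is_word G S xs g" "length xs = wl g" by (rule shortest_word[OF assms(1)])
  obtain ys where ys: "is_word G S ys h" "length ys = wl h" by (rule shortest_word[OF assms(2)])
  show ?thesis using word_length_le[OF is_word_append[OF gens_closed xs(1) ys(1)]] xs(2) ys(2) by simp
qed

lemma wl_letter_le: "s \<in> letters \<Longrightarrow> wl s \<le> 1"
  using word_length_le[OF is_word_letter[OF gens_closed, of s]] by simp

lemma wl_pos:
  assumes "g \<in> carrier G" "g \<noteq> \<one>"
  shows "1 \<le> wl g"
proof -
  obtain ws where "is_word G S ws g" "length ws = wl g" by (rule shortest_word[OF assms(1)])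
  then show ?thesis using assms(2) by (cases ws) (auto simp: is_word_def)
qed

lemma finite_ball: "finite {g \<in> carrier G. wl g \<le> n}"
proof -
  have "finite letters" using fin_gen by (simp add: fin_generating_def)
  then have "finite ((\<lambda>ws. foldr (\<lambda>s h. s \<otimes> h) ws \<one>) ` {ws. set ws \<subseteq> letters \<and> length ws \<le> n})"
    by (intro finite_imageI finite_lists_length_le)
  moreover have "{g \<in> carrier G. wl g \<le> n} \<subseteq>
      (\<lambda>ws. foldr (\<lambda>s h. s \<otimes> h) ws \<one>) ` {ws. set ws \<subseteq> letters \<and> length ws \<le> n}"
  proof
    fix g assume g: "g \<in> {g \<in> carrier G. wl g \<le> n}"
    then obtain ws where ws: "is_word G S ws g" "length ws = wl g" using shortest_word by blast
    then show "g \<in> (\<lambda>ws. foldr (\<lambda>s h. s \<otimes> h) ws \<one>) ` {ws. set ws \<subseteq> letters \<and> length ws \<le> n}"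
      using g by (intro image_eqI[of _ _ ws]) (auto simp: is_word_def)
  qed
  ultimately show ?thesis by (rule finite_subset[rotated])
qed

abbreviation gdist where "gdist g h \<equiv> wl (inv g \<otimes> h)"

lemma gdist_triangle:
  assumes "a \<in> carrier G" "b \<in> carrier G" "c \<in> carrier G"
  shows "gdist a c \<le> gdist a b + gdist b c"
proof -
  have "inv a \<otimes> c = (inv a \<otimes> b) \<otimes> (inv b \<otimes> c)"
    using assms by (metis inv_closed m_assoc m_closed r_cancel_one' r_inv l_one)
  then show ?thesis using wl_mult_le[of "inv a \<otimes> b" "inv b \<otimes> c"] assms by simp
qed

end

section \<open>Travelling salesman walks and spanning trees in a Cayley graph\<close>

context finitely_generated_group
begin

lemma cayley_adj_closed:
  "cayley_adj G S b c \<Longrightarrow> b \<in> carrier G" "cayley_adj G S b c \<Longrightarrow> c \<in> carrier G"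
  by (simp_all add: cayley_adj_def)

lemma cayley_adj_sym: "cayley_adj G S b c \<Longrightarrow> cayley_adj G S c b"
  unfolding cayley_adj_def by blast

lemma cayley_adj_iff:
  assumes "b \<in> carrier G"
  shows "cayley_adj G S b c \<longleftrightarrow> (\<exists>s\<in>letters. c = b \<otimes> s)"
proof
  assume a: "cayley_adj G S b c"
  then obtain t where t: "t \<in> S" "c = b \<otimes> t \<or> b = c \<otimes> t" and c: "c \<in> carrier G"
    unfolding cayley_adj_def by blast
  have tc: "t \<in> carrier G" using t(1) gens_closed by blast
  from t(2) show "\<exists>s\<in>letters. c = b \<otimes> s"
  proof
    assume "c = b \<otimes> t" then show ?thesis using t(1) by blast
  next
    assume "b = c \<otimes> t"
    then have "c = b \<otimes> inv t" using c tc by (simp add: m_assoc)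
    then show ?thesis using t(1) by blast
  qed
next
  assume "\<exists>s\<in>letters. c = b \<otimes> s"
  then obtain t where t: "t \<in> S" "c = b \<otimes> t \<or> c = b \<otimes> inv t" by blast
  have tc: "t \<in> carrier G" using t(1) gens_closed by blast
  have "c = b \<otimes> t \<or> b = c \<otimes> t" using t(2) tc assms by (auto simp: m_assoc)
  moreover have "c \<in> carrier G" using t(2) tc assms by auto
  ultimately show "cayley_adj G S b c" using t(1) assms unfolding cayley_adj_def by blast
qed

lemma gdist_adj_le:
  assumes "cayley_adj G S b c"
  shows "gdist b c \<le> 1"
proof -
  have b: "b \<in> carrier G" using cayley_adj_closed[OF assms] by simp
  obtain s where s: "s \<in> letters" "c = b \<otimes> s" using assms cayley_adj_iff[OF b] by blast
  then have "s \<in> carrier G" using letters_closed[OF gens_closed] by blast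
  then have "inv b \<otimes> c = s" using s b by (simp add: m_assoc[symmetric])
  then show ?thesis using wl_letter_le[OF s(1)] by simp
qed

lemma geodesic:
  assumes "b \<in> carrier G" "c \<in> carrier G"
  obtains p where "walk (cayley_adj G S) b p c" "length p = Suc (gdist b c)"
proof -
  have word_walk: "\<exists>p. walk (cayley_adj G S) b p (b \<otimes> g) \<and> length p = Suc (length ws)"
    if "is_word G S ws g" for ws g
    using gens_closed that
  proof (induction rule: is_word_snoc_induct)
    case Nil
    show ?case using assms(1) walk_singleton[of _ b] by (intro exI[of _ "[b]"]) simp
  next
    case (snoc ws g s)
    then obtain p where p: "walk (cayley_adj G S) b p (b \<otimes> g)" "length p = Suc (length ws)" by blast
    have g: "g \<in> carrier G" "s \<in> carrier G"
      using is_word_closed[OF gens_closed snoc(1)] subsetD[OF letters_closed[OF gens_closed] snoc(2)] by auto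
    have "cayley_adj G S (b \<otimes> g) (b \<otimes> (g \<otimes> s))"
      using snoc(2) g assms(1) by (subst cayley_adj_iff) (auto simp: m_assoc[symmetric])
    then show ?case using walk_snoc[OF p(1)] p(2) by (intro exI[of _ "p @ [b \<otimes> (g \<otimes> s)]"]) simp
  qed
  obtain ws where ws: "is_word G S ws (inv b \<otimes> c)" "length ws = gdist b c"
    using shortest_word[of "inv b \<otimes> c"] assms by auto
  have "b \<otimes> (inv b \<otimes> c) = c" using assms by (simp add: m_assoc[symmetric])
  then show thesis using word_walk[OF ws(1)] ws(2) that by auto
qed

lemma walk_vertices_closed:
  assumes "walk (cayley_adj G S) u p v" "u \<in> carrier G"
  shows "set p \<subseteq> carrier G"
  using assms
proof (induction p arbitrary: u)
  case (Cons x p)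
  then show ?case
    by (cases p) (auto simp: walk_def dest: cayley_adj_closed)
qed simp

lemma dist_weight_eq:
  "b \<in> carrier G \<Longrightarrow> c \<in> carrier G \<Longrightarrow> dist_weight G S {b, c} = real (gdist b c)"
  by (rule dist_weight_pair[OF is_group gens_closed])

lemma dist_weight_nonneg:
  assumes "V \<subseteq> carrier G" "e \<in> complete_edges V"
  shows "0 \<le> dist_weight G S e"
proof -
  obtain b c where e: "e = {b, c}" "b \<in> V" "c \<in> V"
    using assms(2) unfolding complete_edges_def by blast
  then show ?thesis unfolding e(1) using assms(1) by (subst dist_weight_eq) auto
qed

text \<open>
  The depth-first tour of a tree, built by induction: attaching a vertex \<open>y\<close> to \<open>x\<close> lengthens the tour
  by a detour along a geodesic from \<open>x\<close> to \<open>y\<close> and back, which costs twice the weight of the new edge.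
\<close>
lemma tour_along_connected_graph:
  assumes V: "finite V" "V \<subseteq> carrier G" and F: "connected_graph V F" "F \<subseteq> complete_edges V"
    and u: "u \<in> V"
  obtains p where "walk (cayley_adj G S) u p u" "V \<subseteq> set p"
    "real (length p) \<le> 1 + 2 * (\<Sum>e\<in>F. dist_weight G S e)"
proof -
  let ?P = "\<lambda>W H. finite W \<and> (\<exists>p. walk (cayley_adj G S) u p u \<and> W \<subseteq> set p \<and>
    real (length p) \<le> 1 + 2 * (\<Sum>e\<in>H. dist_weight G S e))"
  have "\<exists>H\<subseteq>F. ?P V H"
  proof (rule connected_graph_growth[where P = ?P, OF V(1) F u])
    show "?P {u} {}" using walk_singleton[of _ u] by (intro conjI exI[of _ "[u]"]) auto
  next
    fix W H x y
    assume P: "?P W H" and W: "W \<subseteq> V" and H: "H \<subseteq> complete_edges W"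
      and x: "x \<in> W" and y: "y \<in> V - W"
    obtain p where p: "walk (cayley_adj G S) u p u" "W \<subseteq> set p"
      "real (length p) \<le> 1 + 2 * (\<Sum>e\<in>H. dist_weight G S e)" using P by blast
    have xy: "x \<in> carrier G" "y \<in> carrier G" using x y W V by auto
    obtain q where q: "walk (cayley_adj G S) x q y" "length q = Suc (gdist x y)"
      by (rule geodesic[OF xy])
    have "x \<in> set p" using p(2) x by blast
    then obtain p1 p2 where p12: "walk (cayley_adj G S) u p1 x" "walk (cayley_adj G S) x p2 u"
      "p = p1 @ tl p2" by (rule walk_split[OF p(1)])
    let ?a = "p1 @ tl q"
    let ?b = "?a @ tl (rev q)"
    let ?c = "?b @ tl p2"
    note a = walk_append[OF p12(1) q(1)]
    note b = walk_append[OF a(1) walk_rev[OF q(1) cayley_adj_sym]]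
    note c = walk_append[OF b(1) p12(2)]
    note d = walk_append[OF p12(1,2)]
    have yq: "y \<in> set q" using q(1) unfolding walk_def by auto
    have "set ?c = set p1 \<union> set q \<union> set (rev q) \<union> set p2"
      by (simp only: c(2) b(2) a(2))
    moreover have "set p = set p1 \<union> set p2" using d(2) p12(3) by simp
    ultimately have cover: "insert y W \<subseteq> set ?c" using p(2) yq by blast
    have "length ?c = length p + 2 * gdist x y"
      using c(3) b(3) a(3) d(3) q(2) p12(3) by simp
    moreover have "{x, y} \<notin> H" using H y unfolding complete_edges_def by (auto simp: doubleton_eq_iff)
    moreover have "finite H" using H P finite_complete_edges finite_subset by metis
    ultimately have "real (length ?c) \<le> 1 + 2 * (\<Sum>e\<in>insert {x, y} H. dist_weight G S e)"
      using p(3) dist_weight_eq[OF xy] by simp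
    then show "?P (insert y W) (insert {x, y} H)" using P c(1) cover by blast
  qed
  then obtain H p where H: "H \<subseteq> F" and p: "walk (cayley_adj G S) u p u" "V \<subseteq> set p"
    "real (length p) \<le> 1 + 2 * (\<Sum>e\<in>H. dist_weight G S e)" by blast
  have "(\<Sum>e\<in>H. dist_weight G S e) \<le> (\<Sum>e\<in>F. dist_weight G S e)"
    using H F(2) dist_weight_nonneg[OF V(2)] finite_subset[OF F(2) finite_complete_edges[OF V(1)]]
    by (intro sum_mono2) auto
  then show thesis using p by (intro that[of p]) auto
qed

text \<open>
  To end at \<open>v\<close> instead of \<open>u\<close>, the closed tour is followed by its own initial segment up to a visit to
  \<open>v\<close>. Its length is at most that of the tour, so the factor is \<open>4\<close> instead of \<open>2\<close>.
\<close>
lemma tsp_walk_along_connected_graph: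
  assumes V: "finite V" "V \<subseteq> carrier G" and F: "connected_graph V F" "F \<subseteq> complete_edges V"
    and uv: "u \<in> V" "v \<in> V"
  obtains p where "walk (cayley_adj G S) u p v" "V \<subseteq> set p"
    "real (length p) \<le> 1 + 4 * (\<Sum>e\<in>F. dist_weight G S e)"
proof -
  obtain p where p: "walk (cayley_adj G S) u p u" "V \<subseteq> set p"
    "real (length p) \<le> 1 + 2 * (\<Sum>e\<in>F. dist_weight G S e)"
    by (rule tour_along_connected_graph[OF V F uv(1)])
  have "v \<in> set p" using p(2) uv(2) by blast
  then obtain q r where q: "walk (cayley_adj G S) u q v" and r: "p = q @ tl r"
    by (rule walk_split[OF p(1)])
  note a = walk_append[OF p(1) q]
  have "length q \<le> length p" using r by simp
  then have "real (length (p @ tl q)) \<le> 1 + 4 * (\<Sum>e\<in>F. dist_weight G S e)"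
    using a(3) p(3) by linarith
  moreover have "V \<subseteq> set (p @ tl q)" using p(2) by auto
  ultimately show thesis using that a(1) by blast
qed

lemma tsp_length_less:
  assumes "walk (cayley_adj G S) u p v" "V \<subseteq> set p"
  shows "tsp_length G S u V v < length p"
proof -
  have "tsp_length G S u V v \<le> length p - 1"
    unfolding tsp_length_def using assms by (intro Least_le exI[of _ p]) (auto simp: walk_def)
  then show ?thesis using assms(1) by (cases p) (auto simp: walk_def)
qed

lemma tsp_length_attained:
  assumes V: "finite V" "V \<subseteq> carrier G" and uv: "u \<in> carrier G" "v \<in> carrier G"
  obtains p where "walk (cayley_adj G S) u p v" "V \<subseteq> set p" "length p = Suc (tsp_length G S u V v)"
proof -
  obtain p where p: "walk (cayley_adj G S) u p v" "V \<subseteq> set p"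
  proof (rule tsp_walk_along_connected_graph[of "{u, v} \<union> V" _ u v, OF _ _ connected_complete order_refl])
    show "finite ({u, v} \<union> V)" "{u, v} \<union> V \<subseteq> carrier G" "u \<in> {u, v} \<union> V" "v \<in> {u, v} \<union> V"
      using V uv by auto
  qed auto
  then have "\<exists>n q. length q = Suc n \<and> successively (cayley_adj G S) q \<and>
      hd q = u \<and> last q = v \<and> V \<subseteq> set q"
    by (intro exI[of _ "length p - 1"] exI[of _ p]) (auto simp: walk_def)
  then have "\<exists>q. length q = Suc (tsp_length G S u V v) \<and> successively (cayley_adj G S) q \<and>
      hd q = u \<and> last q = v \<and> V \<subseteq> set q"
    unfolding tsp_length_def by (rule LeastI_ex)
  then obtain q where q: "length q = Suc (tsp_length G S u V v)" "successively (cayley_adj G S) q"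
    "hd q = u" "last q = v" "V \<subseteq> set q" by blast
  have "q \<noteq> []" using q(1) by auto
  then show thesis using that[of q] q by (simp add: walk_def)
qed

lemma tsp_length_le_mst:
  assumes V: "finite V" "V \<subseteq> carrier G" and uv: "u \<in> carrier G" "v \<in> carrier G"
  shows "real (tsp_length G S u V v) \<le> 4 * mst_weight ({u, v} \<union> V) (dist_weight G S)"
proof -
  let ?V = "{u, v} \<union> V"
  have fin: "finite ?V" "?V \<subseteq> carrier G" "u \<in> ?V" "v \<in> ?V" using V uv by auto
  obtain F where F: "spanning_tree_on ?V F" "mst_weight ?V (dist_weight G S) = (\<Sum>e\<in>F. dist_weight G S e)"
    by (rule mst_weight_attained[OF fin(1)])
  have F': "connected_graph ?V F" "F \<subseteq> complete_edges ?V"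
    using F(1) by (simp_all add: spanning_tree_on_def)
  obtain p where p: "walk (cayley_adj G S) u p v" "?V \<subseteq> set p"
    "real (length p) \<le> 1 + 4 * (\<Sum>e\<in>F. dist_weight G S e)"
    by (rule tsp_walk_along_connected_graph[OF fin(1,2) F' fin(3,4)])
  have "tsp_length G S u V v < length p" using tsp_length_less[OF p(1)] p(2) by blast
  then show ?thesis using p(3) F(2) by linarith
qed

text \<open>
  Joining the successive visits of a walk to \<open>V\<close> gives a connected graph, and the triangle inequality
  bounds its weight by the number of steps. In the induction from the end of the walk, \<open>z\<close> is the
  next visited point of \<open>V\<close>; the distance from the current position \<open>u\<close> to \<open>z\<close> is the part of the walk
  that no edge accounts for yet.
\<close>
lemma connected_graph_along_walk:
  assumes "walk (cayley_adj G S) u p v" "u \<in> carrier G" "V \<inter> set p \<noteq> {}"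
  shows "\<exists>z\<in>V \<inter> set p. \<exists>F\<subseteq>complete_edges (V \<inter> set p). connected_graph (V \<inter> set p) F \<and>
    real (gdist u z) + (\<Sum>e\<in>F. dist_weight G S e) + 1 \<le> real (length p)"
  using assms
proof (induction p arbitrary: u)
  case Nil
  then show ?case by simp
next
  case (Cons x p)
  have xu: "x = u" using Cons.prems(1) by (simp add: walk_def)
  show ?case
  proof (cases "V \<inter> set p = {}")
    case True
    then have "V \<inter> set (x # p) = {u}" using Cons.prems(3) xu by auto
    then show ?thesis using Cons.prems(2)
      by (intro bexI[of _ u] exI[of _ "{}"]) (auto simp: connected_graph_def)
  next
    case False
    then have ne: "p \<noteq> []" by auto
    define y where "y = hd p"
    have y: "cayley_adj G S u y" "walk (cayley_adj G S) y p v"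
      using Cons.prems(1) ne by (auto simp: walk_def successively_Cons y_def)
    have yc: "y \<in> carrier G" using cayley_adj_closed[OF y(1)] by simp
    obtain z F where z: "z \<in> V \<inter> set p" and F: "F \<subseteq> complete_edges (V \<inter> set p)"
      "connected_graph (V \<inter> set p) F"
      "real (gdist y z) + (\<Sum>e\<in>F. dist_weight G S e) + 1 \<le> real (length p)"
      using Cons.IH[OF y(2) yc False] by blast
    have zc: "z \<in> carrier G" using z walk_vertices_closed[OF y(2) yc] by blast
    have "gdist u z \<le> 1 + gdist y z"
      using gdist_triangle[OF Cons.prems(2) yc zc] gdist_adj_le[OF y(1)] by linarith
    then have len: "real (gdist u z) + (\<Sum>e\<in>F. dist_weight G S e) + 1 \<le> real (length (x # p))"
      using F(3) by simp
    show ?thesis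
    proof (cases "u \<in> V")
      case False
      then have "V \<inter> set (x # p) = V \<inter> set p" using xu by auto
      then show ?thesis using z F len by auto
    next
      case True
      have eq: "V \<inter> set (x # p) = insert u (V \<inter> set p)" using True xu by auto
      show ?thesis
      proof (cases "u = z")
        case True
        then have "V \<inter> set (x # p) = V \<inter> set p" using eq z by auto
        then show ?thesis using z F len by auto
      next
        case False
        have "{z, u} \<in> complete_edges (insert u (V \<inter> set p))"
          using z False unfolding complete_edges_def by blast
        then have "insert {z, u} F \<subseteq> complete_edges (insert u (V \<inter> set p))"
          using F(1) complete_edges_mono[of "V \<inter> set p" "insert u (V \<inter> set p)"] by blast
        moreover have "connected_graph (insert u (V \<inter> set p)) (insert {z, u} F)"
          by (rule connected_graph_insert[OF F(2) z])
        moreover have "(\<Sum>e\<in>insert {z, u} F. dist_weight G S e) \<le>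
            real (gdist u z) + (\<Sum>e\<in>F. dist_weight G S e)"
        proof -
          have "finite F" using finite_subset[OF F(1) finite_complete_edges] by simp
          then show ?thesis using dist_weight_eq[OF Cons.prems(2) zc]
            by (cases "{z, u} \<in> F") (auto simp: insert_absorb insert_commute)
        qed
        ultimately show ?thesis unfolding eq
          using len Cons.prems(2) by (intro bexI[of _ u] exI[of _ "insert {z, u} F"]) auto
      qed
    qed
  qed
qed

lemma mst_le_tsp_length:
  assumes V: "finite V" "V \<subseteq> carrier G" and uv: "u \<in> carrier G" "v \<in> carrier G"
  shows "mst_weight ({u, v} \<union> V) (dist_weight G S) \<le> real (tsp_length G S u V v)"
proof -
  let ?V = "{u, v} \<union> V"
  obtain p where p: "walk (cayley_adj G S) u p v" "V \<subseteq> set p"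
    "length p = Suc (tsp_length G S u V v)"
    by (rule tsp_length_attained[OF V uv])
  have "{u, v} \<subseteq> set p" using p(1) unfolding walk_def by auto
  then have eq: "?V \<inter> set p = ?V" using p(2) by blast
  then obtain z F where F: "F \<subseteq> complete_edges ?V" "connected_graph ?V F"
    "real (gdist u z) + (\<Sum>e\<in>F. dist_weight G S e) + 1 \<le> real (length p)"
    using connected_graph_along_walk[OF p(1) uv(1), of ?V] by auto
  have "mst_weight ?V (dist_weight G S) \<le> (\<Sum>e\<in>F. dist_weight G S e)"
    using V uv by (intro mst_weight_le_connected[OF _ F(1,2)] dist_weight_nonneg[of ?V]) auto
  then show ?thesis using F(3) p(3) by simp
qed

lemma card_le_tsp_length:
  assumes V: "finite V" "V \<subseteq> carrier G" and uv: "u \<in> carrier G" "v \<in> carrier G"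
  shows "card V \<le> Suc (tsp_length G S u V v)"
proof -
  obtain p where p: "V \<subseteq> set p" "length p = Suc (tsp_length G S u V v)"
    by (rule tsp_length_attained[OF V uv])
  then show ?thesis using card_mono[of "set p" V] card_length[of p] by simp
qed

lemma gdist_le_tsp_length:
  assumes V: "finite V" "V \<subseteq> carrier G" and uv: "u \<in> carrier G" "v \<in> carrier G"
  shows "gdist u v \<le> tsp_length G S u V v"
proof -
  obtain p where p: "walk (cayley_adj G S) u p v" "length p = Suc (tsp_length G S u V v)"
    by (rule tsp_length_attained[OF V uv])
  have v: "{v} \<inter> set p = {v}" using p(1) unfolding walk_def by auto
  obtain F where F: "F \<subseteq> complete_edges {v}"
    "real (gdist u v) + (\<Sum>e\<in>F. dist_weight G S e) + 1 \<le> real (length p)"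
    using connected_graph_along_walk[OF p(1) uv(1), of "{v}", unfolded v] by blast
  have "F = {}" using F(1) unfolding complete_edges_def by blast
  then show ?thesis using F(2) p(2) by simp
qed

end

section \<open>Word length in the wreath product\<close>

locale finitely_generated_wreath =
  A: finitely_generated_group A S + B: finitely_generated_group B T
  for A :: "('a, 'm) monoid_scheme" and S and B :: "('b, 'n) monoid_scheme" and T
begin

abbreviation W where "W \<equiv> wreath A B"
abbreviation gens where "gens \<equiv> wreath_gens A B S T"
abbreviation base where "base \<equiv> carrier (sum_group (carrier B) (\<lambda>_. A))"

definition value_length :: "('b \<Rightarrow> 'a) \<times> 'b \<Rightarrow> nat" where
  "value_length x = (\<Sum>b\<in>supp A B x. A.wl (fst x b))"

sublocale W: group W
  by (rule group_wreath[OF A.is_group B.is_group])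

lemma base_iff:
  "f \<in> base \<longleftrightarrow> f \<in> carrier B \<rightarrow>\<^sub>E carrier A \<and> finite {b \<in> carrier B. f b \<noteq> \<one>\<^bsub>A\<^esub>}"
  by (simp add: carrier_sum_group)

lemma carrier_W: "carrier W = base \<times> carrier B"
  by (simp add: wreath_def)

lemma base_value_closed: "f \<in> base \<Longrightarrow> b \<in> carrier B \<Longrightarrow> f b \<in> carrier A"
  by (auto simp: base_iff)

lemma finite_supp: "x \<in> carrier W \<Longrightarrow> finite (supp A B x)"
  by (auto simp: carrier_W base_iff supp_def)

lemma supp_closed: "supp A B x \<subseteq> carrier B"
  by (auto simp: supp_def)

lemma supp_upd: "supp A B (f(b := a), c') \<subseteq> insert b (supp A B (f, c))"
  by (auto simp: supp_def)

lemma base_upd: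
  assumes "f \<in> base" "b \<in> carrier B" "a \<in> carrier A"
  shows "f(b := a) \<in> base"
proof -
  have "{x \<in> carrier B. (f(b := a)) x \<noteq> \<one>\<^bsub>A\<^esub>} \<subseteq> insert b {x \<in> carrier B. f x \<noteq> \<one>\<^bsub>A\<^esub>}" by auto
  then have "finite {x \<in> carrier B. (f(b := a)) x \<noteq> \<one>\<^bsub>A\<^esub>}"
    using assms(1) unfolding base_iff by (meson finite.insertI finite_subset)
  moreover have "f(b := a) \<in> carrier B \<rightarrow>\<^sub>E carrier A"
    using assms unfolding base_iff by (auto simp: PiE_iff extensional_def)
  ultimately show ?thesis unfolding base_iff by blast
qed

text \<open>
  Changing one value of the lamp configuration changes the total length only by the term at that index.
  It is an equation between sums because subtraction of natural numbers truncates.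
\<close>
lemma value_length_upd:
  assumes "f \<in> base" "b \<in> carrier B"
  shows "value_length (f(b := a), c') + A.wl (f b) = value_length (f, c) + A.wl a"
proof -
  let ?K = "insert b (supp A B (f, c))"
  have fin: "finite (supp A B (f, c))"
    using assms(1) unfolding base_iff by (simp add: supp_def)
  have "value_length (f(b := a), c') = (\<Sum>x\<in>?K. A.wl ((f(b := a)) x))"
    unfolding value_length_def fst_conv
    using fin by (intro sum.mono_neutral_left) (auto simp: supp_def assms(2))
  also have "\<dots> = A.wl a + (\<Sum>x\<in>?K - {b}. A.wl ((f(b := a)) x))"
    using fin by (subst sum.remove[of _ b]) auto
  also have "(\<Sum>x\<in>?K - {b}. A.wl ((f(b := a)) x)) = (\<Sum>x\<in>?K - {b}. A.wl (f x))"
    by (intro sum.cong) auto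
  finally have 1: "value_length (f(b := a), c') = A.wl a + (\<Sum>x\<in>?K - {b}. A.wl (f x))" .
  have "value_length (f, c) = (\<Sum>x\<in>?K. A.wl (f x))"
    unfolding value_length_def fst_conv
    using fin by (intro sum.mono_neutral_left) (auto simp: supp_def assms(2))
  also have "\<dots> = A.wl (f b) + (\<Sum>x\<in>?K - {b}. A.wl (f x))"
    using fin by (subst sum.remove[of _ b]) auto
  finally show ?thesis using 1 by simp
qed

lemma embed_base_closed: "a \<in> carrier A \<Longrightarrow> embed_base A B a \<in> carrier W"
proof -
  assume a: "a \<in> carrier A"
  have "{b \<in> carrier B. single A B \<one>\<^bsub>B\<^esub> a b \<noteq> \<one>\<^bsub>A\<^esub>} \<subseteq> {\<one>\<^bsub>B\<^esub>}" by (auto simp: single_def)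
  then have "finite {b \<in> carrier B. single A B \<one>\<^bsub>B\<^esub> a b \<noteq> \<one>\<^bsub>A\<^esub>}" using finite_subset by blast
  then show ?thesis using a
    unfolding carrier_W embed_base_def mem_Times_iff base_iff by (auto simp: single_def PiE_iff)
qed

lemma embed_top_closed: "b \<in> carrier B \<Longrightarrow> embed_top A B b \<in> carrier W"
  by (auto simp: carrier_W embed_top_def base_iff PiE_iff)

lemma mult_embed_base:
  assumes "f \<in> base" "b \<in> carrier B" "a \<in> carrier A"
  shows "(f, b) \<otimes>\<^bsub>W\<^esub> embed_base A B a = (f(b := f b \<otimes>\<^bsub>A\<^esub> a), b)"
proof -
  have iff: "inv\<^bsub>B\<^esub> b \<otimes>\<^bsub>B\<^esub> x = \<one>\<^bsub>B\<^esub> \<longleftrightarrow> x = b" if "x \<in> carrier B" for x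
    using that assms(2) by (metis B.inv_closed B.inv_equality B.inv_inv B.l_inv)
  have "(\<lambda>x\<in>carrier B. f x \<otimes>\<^bsub>A\<^esub> shift B b (single A B \<one>\<^bsub>B\<^esub> a) x) = f(b := f b \<otimes>\<^bsub>A\<^esub> a)"
  proof
    fix x
    show "(\<lambda>x\<in>carrier B. f x \<otimes>\<^bsub>A\<^esub> shift B b (single A B \<one>\<^bsub>B\<^esub> a) x) x = (f(b := f b \<otimes>\<^bsub>A\<^esub> a)) x"
    proof (cases "x \<in> carrier B")
      case True
      then show ?thesis
        using assms iff[OF True] base_value_closed[OF assms(1) True] by (simp add: shift_def single_def)
    next
      case False
      then have "f x = undefined" using assms(1) by (auto simp: base_iff PiE_iff extensional_def)
      then show ?thesis using False assms(2) by auto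
    qed
  qed
  then show ?thesis using assms(2) by (simp add: wreath_def embed_base_def)
qed

lemma mult_embed_top:
  assumes "f \<in> base" "b \<in> carrier B" "t \<in> carrier B"
  shows "(f, b) \<otimes>\<^bsub>W\<^esub> embed_top A B t = (f, b \<otimes>\<^bsub>B\<^esub> t)"
proof -
  have "(\<lambda>x\<in>carrier B. f x \<otimes>\<^bsub>A\<^esub> shift B b (\<lambda>i\<in>carrier B. \<one>\<^bsub>A\<^esub>) x) = f"
  proof
    fix x
    show "(\<lambda>x\<in>carrier B. f x \<otimes>\<^bsub>A\<^esub> shift B b (\<lambda>i\<in>carrier B. \<one>\<^bsub>A\<^esub>) x) x = f x"
    proof (cases "x \<in> carrier B")
      case True
      then show ?thesis
        using assms(2) base_value_closed[OF assms(1) True] by (simp add: shift_def)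
    next
      case False
      then show ?thesis using assms(1) by (auto simp: base_iff PiE_iff extensional_def)
    qed
  qed
  then show ?thesis by (simp add: wreath_def embed_top_def)
qed

lemma inv_embed_base:
  assumes "a \<in> carrier A"
  shows "inv\<^bsub>W\<^esub> embed_base A B a = embed_base A B (inv\<^bsub>A\<^esub> a)"
proof (rule W.inv_equality)
  let ?f = "single A B \<one>\<^bsub>B\<^esub> (inv\<^bsub>A\<^esub> a)"
  have "embed_base A B (inv\<^bsub>A\<^esub> a) \<in> carrier W" using embed_base_closed assms by simp
  then have "?f \<in> base" by (simp add: carrier_W embed_base_def)
  then have "embed_base A B (inv\<^bsub>A\<^esub> a) \<otimes>\<^bsub>W\<^esub> embed_base A B a
      = (?f(\<one>\<^bsub>B\<^esub> := ?f \<one>\<^bsub>B\<^esub> \<otimes>\<^bsub>A\<^esub> a), \<one>\<^bsub>B\<^esub>)"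
    using mult_embed_base[of ?f "\<one>\<^bsub>B\<^esub>" a] assms by (simp add: embed_base_def)
  also have "\<dots> = \<one>\<^bsub>W\<^esub>" using assms by (auto simp: wreath_def single_def)
  finally show "embed_base A B (inv\<^bsub>A\<^esub> a) \<otimes>\<^bsub>W\<^esub> embed_base A B a = \<one>\<^bsub>W\<^esub>" .
qed (use assms embed_base_closed in auto)

lemma inv_embed_top:
  assumes "b \<in> carrier B"
  shows "inv\<^bsub>W\<^esub> embed_top A B b = embed_top A B (inv\<^bsub>B\<^esub> b)"
proof (rule W.inv_equality)
  have "embed_top A B (inv\<^bsub>B\<^esub> b) \<in> carrier W" using embed_top_closed assms by simp
  then show "embed_top A B (inv\<^bsub>B\<^esub> b) \<otimes>\<^bsub>W\<^esub> embed_top A B b = \<one>\<^bsub>W\<^esub>"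
    using mult_embed_top[of "\<one>\<^bsub>sum_group (carrier B) (\<lambda>_. A)\<^esub>" "inv\<^bsub>B\<^esub> b" b] assms
    by (simp add: embed_top_def carrier_W wreath_def)
qed (use assms embed_top_closed in auto)

lemma gens_closed: "gens \<subseteq> carrier W"
  using A.gens_closed B.gens_closed embed_base_closed embed_top_closed
  by (auto simp: wreath_gens_def)

lemma letters_W:
  "gens \<union> (\<lambda>s. inv\<^bsub>W\<^esub> s) ` gens = embed_base A B ` A.letters \<union> embed_top A B ` B.letters"
proof -
  have "(\<lambda>s. inv\<^bsub>W\<^esub> s) ` embed_base A B ` S = embed_base A B ` (\<lambda>s. inv\<^bsub>A\<^esub> s) ` S"
    unfolding image_image using A.gens_closed by (intro image_cong) (auto simp: inv_embed_base)
  moreover have "(\<lambda>s. inv\<^bsub>W\<^esub> s) ` embed_top A B ` T = embed_top A B ` (\<lambda>s. inv\<^bsub>B\<^esub> s) ` T"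
    unfolding image_image using B.gens_closed by (intro image_cong) (auto simp: inv_embed_top)
  ultimately show ?thesis by (simp add: wreath_gens_def image_Un Un_ac)
qed

lemma word_embed_base:
  assumes "is_word A S ws a"
  shows "is_word W gens (map (embed_base A B) ws) (embed_base A B a)"
  using A.gens_closed assms
proof (induction rule: A.is_word_snoc_induct)
  case Nil
  have "embed_base A B \<one>\<^bsub>A\<^esub> = \<one>\<^bsub>W\<^esub>" by (auto simp: embed_base_def wreath_def single_def)
  then show ?case using W.is_word_Nil by simp
next
  case (snoc ws g s)
  have s: "embed_base A B s \<in> gens \<union> (\<lambda>s. inv\<^bsub>W\<^esub> s) ` gens"
    unfolding letters_W using snoc.hyps(2) by blast
  have c: "g \<in> carrier A" "s \<in> carrier A"
    using A.is_word_closed[OF A.gens_closed snoc.hyps(1)] A.letters_closed[OF A.gens_closed] snoc.hyps(2)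
    by blast+
  let ?f = "single A B \<one>\<^bsub>B\<^esub> g"
  have "?f \<in> base" using embed_base_closed[OF c(1)] by (simp add: carrier_W embed_base_def)
  then have "embed_base A B g \<otimes>\<^bsub>W\<^esub> embed_base A B s = (?f(\<one>\<^bsub>B\<^esub> := ?f \<one>\<^bsub>B\<^esub> \<otimes>\<^bsub>A\<^esub> s), \<one>\<^bsub>B\<^esub>)"
    using mult_embed_base[of ?f "\<one>\<^bsub>B\<^esub>" s] c by (simp add: embed_base_def)
  also have "\<dots> = embed_base A B (g \<otimes>\<^bsub>A\<^esub> s)" by (auto simp: embed_base_def single_def)
  finally show ?case
    using W.is_word_append[OF gens_closed snoc.IH W.is_word_letter[OF gens_closed s]] by simp
qed

text \<open>
  A value at the cursor position can be written last, so it may be assumed trivial while the cursor is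
  moved there.
\<close>
lemma word_set_value:
  assumes f: "f \<in> base" and v: "v \<in> carrier B"
    and ws: "is_word W gens ws (f(v := \<one>\<^bsub>A\<^esub>), v)"
    and len: "length ws + 1 \<le> n + value_length (f(v := \<one>\<^bsub>A\<^esub>), v)"
  shows "\<exists>ws. is_word W gens ws (f, v) \<and> length ws + 1 \<le> n + value_length (f, v)"
proof -
  have fv: "f v \<in> carrier A" by (rule base_value_closed[OF f v])
  obtain as where as: "is_word A S as (f v)" "length as = A.wl (f v)" by (rule A.shortest_word[OF fv])
  have "f(v := \<one>\<^bsub>A\<^esub>) \<in> base" using base_upd[OF f v] by simp
  then have "(f(v := \<one>\<^bsub>A\<^esub>), v) \<otimes>\<^bsub>W\<^esub> embed_base A B (f v) = (f, v)"
    using mult_embed_base[of "f(v := \<one>\<^bsub>A\<^esub>)" v "f v"] v fv by simp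
  then have "is_word W gens (ws @ map (embed_base A B) as) (f, v)"
    using W.is_word_append[OF gens_closed ws word_embed_base[OF as(1)]] by simp
  moreover have "value_length (f(v := \<one>\<^bsub>A\<^esub>), v) + A.wl (f v) = value_length (f, v)"
    using value_length_upd[OF f v, of "\<one>\<^bsub>A\<^esub>" v v] by simp
  ultimately show ?thesis
    using len as(2) by (intro exI[of _ "ws @ map (embed_base A B) as"]) simp
qed

text \<open>
  From an itinerary to a word: at each index the value is written at the last visit. Removing the last
  vertex \<open>v\<close> of the walk therefore leaves the configuration with the value at \<open>v\<close> erased, whose support is
  covered by the shorter walk.
\<close>
lemma word_along_walk:
  assumes "walk (cayley_adj B T) \<one>\<^bsub>B\<^esub> p v" "f \<in> base" "supp A B (f, v) \<subseteq> set p"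
  shows "\<exists>ws. is_word W gens ws (f, v) \<and> length ws + 1 \<le> length p + value_length (f, v)"
  using assms
proof (induction p arbitrary: v f rule: rev_induct)
  case Nil
  then show ?case by (simp add: walk_def)
next
  case (snoc y p)
  have y: "y = v" using snoc.prems(1) by (simp add: walk_def)
  have v: "v \<in> carrier B"
    using B.walk_vertices_closed[OF snoc.prems(1)] y by simp
  let ?f = "f(v := \<one>\<^bsub>A\<^esub>)"
  have f': "?f \<in> base" using base_upd[OF snoc.prems(2) v] by simp
  have "\<exists>ws. is_word W gens ws (?f, v) \<and> length ws + 1 \<le> length (p @ [y]) + value_length (?f, v)"
  proof (cases "p = []")
    case True
    then have v1: "v = \<one>\<^bsub>B\<^esub>" using snoc.prems(1) by (auto simp: walk_def)
    have "f x = \<one>\<^bsub>A\<^esub>" if "x \<in> carrier B" "x \<noteq> v" for x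
      using snoc.prems(3) True y that by (auto simp: supp_def)
    then have "?f = (\<lambda>x\<in>carrier B. \<one>\<^bsub>A\<^esub>)"
      using snoc.prems(2) v by (auto simp: base_iff PiE_iff extensional_def fun_eq_iff)
    then have "(?f, v) = \<one>\<^bsub>W\<^esub>" using v1 by (simp add: wreath_def)
    then show ?thesis using W.is_word_Nil by (intro exI[of _ "[]"]) simp
  next
    case False
    \<comment> \<open>The cursor moves from \<open>z\<close> to \<open>v\<close> with the value at \<open>v\<close> still trivial.\<close>
    define z where "z = last p"
    have z: "walk (cayley_adj B T) \<one>\<^bsub>B\<^esub> p z" "cayley_adj B T z v"
      using snoc.prems(1) False y by (auto simp: walk_def successively_append_iff z_def)
    have zc: "z \<in> carrier B" using B.cayley_adj_closed[OF z(2)] by simp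
    obtain t where t: "t \<in> B.letters" "v = z \<otimes>\<^bsub>B\<^esub> t" using z(2) B.cayley_adj_iff[OF zc] by blast
    have tc: "t \<in> carrier B" using t(1) B.letters_closed[OF B.gens_closed] by blast
    have "supp A B (?f, z) \<subseteq> set p"
      using snoc.prems(3) y by (auto simp: supp_def split: if_splits)
    then obtain ws where ws: "is_word W gens ws (?f, z)"
      "length ws + 1 \<le> length p + value_length (?f, z)"
      using snoc.IH[OF z(1) f'] by blast
    have "embed_top A B t \<in> gens \<union> (\<lambda>s. inv\<^bsub>W\<^esub> s) ` gens" unfolding letters_W using t(1) by blast
    then have "is_word W gens (ws @ [embed_top A B t]) (?f, v)"
      using W.is_word_append[OF gens_closed ws(1) W.is_word_letter[OF gens_closed]]
        mult_embed_top[OF f' zc tc] t(2) by metis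
    moreover have "value_length (?f, z) = value_length (?f, v)"
      by (simp add: value_length_def supp_def)
    ultimately show ?thesis using ws(2) by (intro exI[of _ "ws @ [embed_top A B t]"]) simp
  qed
  then show ?case using word_set_value[OF snoc.prems(2) v] by blast
qed

text \<open>
  From a word to an itinerary: the letters of \<open>B\<close> trace a walk of the cursor, and each letter of
  \<open>A\<close> raises the total length of the values by at most \<open>1\<close>, at an index the walk has visited.
\<close>
lemma walk_along_word:
  assumes "is_word W gens ws x"
  shows "\<exists>p. walk (cayley_adj B T) \<one>\<^bsub>B\<^esub> p (snd x) \<and> supp A B x \<subseteq> set p \<and>
    length p + value_length x \<le> Suc (length ws)"
  using gens_closed assms
proof (induction rule: W.is_word_snoc_induct)
  case Nil
  have "supp A B \<one>\<^bsub>W\<^esub> = {}" "snd \<one>\<^bsub>W\<^esub> = \<one>\<^bsub>B\<^esub>" by (auto simp: supp_def wreath_def)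
  then show ?case using walk_singleton[of _ "\<one>\<^bsub>B\<^esub>"]
    by (intro exI[of _ "[\<one>\<^bsub>B\<^esub>]"]) (simp add: value_length_def)
next
  case (snoc ws g s)
  obtain p where p: "walk (cayley_adj B T) \<one>\<^bsub>B\<^esub> p (snd g)" "supp A B g \<subseteq> set p"
    "length p + value_length g \<le> Suc (length ws)" using snoc.IH by blast
  obtain f b where g: "g = (f, b)" by (cases g)
  have fb: "f \<in> base" "b \<in> carrier B"
    using W.is_word_closed[OF gens_closed snoc.hyps(1)] by (simp_all add: g carrier_W)
  have bp: "b \<in> set p" using p(1) unfolding g walk_def by auto
  from snoc.hyps(2) consider a where "a \<in> A.letters" "s = embed_base A B a"
    | t where "t \<in> B.letters" "s = embed_top A B t" unfolding letters_W by blast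
  then show ?case
  proof cases
    case (1 a)
    have a: "a \<in> carrier A" using 1(1) A.letters_closed[OF A.gens_closed] by blast
    have eq: "g \<otimes>\<^bsub>W\<^esub> s = (f(b := f b \<otimes>\<^bsub>A\<^esub> a), b)"
      unfolding g 1(2) by (rule mult_embed_base[OF fb a])
    have "A.wl (f b \<otimes>\<^bsub>A\<^esub> a) \<le> A.wl (f b) + 1"
      using A.wl_mult_le[OF base_value_closed[OF fb] a] A.wl_letter_le[OF 1(1)] by linarith
    then have "value_length (g \<otimes>\<^bsub>W\<^esub> s) \<le> value_length g + 1"
      using value_length_upd[OF fb, of "f b \<otimes>\<^bsub>A\<^esub> a" b b] unfolding eq unfolding g by linarith
    moreover have "supp A B (g \<otimes>\<^bsub>W\<^esub> s) \<subseteq> set p"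
      using supp_upd[of f b "f b \<otimes>\<^bsub>A\<^esub> a" b b] p(2) bp unfolding eq unfolding g by blast
    ultimately show ?thesis using p(1,3) unfolding eq unfolding g by (intro exI[of _ p]) simp
  next
    case (2 t)
    have t: "t \<in> carrier B" using 2(1) B.letters_closed[OF B.gens_closed] by blast
    have eq: "g \<otimes>\<^bsub>W\<^esub> s = (f, b \<otimes>\<^bsub>B\<^esub> t)" unfolding g 2(2) by (rule mult_embed_top[OF fb t])
    have "cayley_adj B T b (b \<otimes>\<^bsub>B\<^esub> t)" using B.cayley_adj_iff[OF fb(2)] 2(1) by blast
    then have "walk (cayley_adj B T) \<one>\<^bsub>B\<^esub> (p @ [b \<otimes>\<^bsub>B\<^esub> t]) (b \<otimes>\<^bsub>B\<^esub> t)"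
      using walk_snoc[of _ _ p b] p(1) unfolding g by simp
    moreover have "supp A B (f, b \<otimes>\<^bsub>B\<^esub> t) = supp A B g"
      "value_length (f, b \<otimes>\<^bsub>B\<^esub> t) = value_length g"
      by (simp_all add: g supp_def value_length_def)
    ultimately show ?thesis
      using p(2,3) unfolding eq by (intro exI[of _ "p @ [b \<otimes>\<^bsub>B\<^esub> t]"]) auto
  qed
qed

lemma word_length_wreath:
  assumes "x \<in> carrier W"
  shows "word_length W gens x
    = value_length x + tsp_length B T \<one>\<^bsub>B\<^esub> (supp A B x) (snd x)"
proof -
  have x: "fst x \<in> base" "snd x \<in> carrier B" using assms by (auto simp: carrier_W)
  obtain p where p: "walk (cayley_adj B T) \<one>\<^bsub>B\<^esub> p (snd x)" "supp A B x \<subseteq> set p"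
    "length p = Suc (tsp_length B T \<one>\<^bsub>B\<^esub> (supp A B x) (snd x))"
    by (rule B.tsp_length_attained[OF finite_supp[OF assms] supp_closed B.one_closed x(2)])
  obtain ws where ws: "is_word W gens ws x" "length ws + 1 \<le> length p + value_length x"
    using word_along_walk[OF p(1) x(1)] p(2) by auto
  obtain us where us: "is_word W gens us x" "length us = word_length W gens x"
    by (rule word_length_attained[OF ws(1)])
  obtain q where q: "walk (cayley_adj B T) \<one>\<^bsub>B\<^esub> q (snd x)" "supp A B x \<subseteq> set q"
    "length q + value_length x \<le> Suc (length us)"
    using walk_along_word[OF us(1)] by blast
  have "tsp_length B T \<one>\<^bsub>B\<^esub> (supp A B x) (snd x) < length q" by (rule B.tsp_length_less[OF q(1,2)])
  then show ?thesis using word_length_le[OF ws(1)] ws(2) us(2) q(3) p(3) by linarith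
qed

end

section \<open>Domination up to affine error\<close>

text \<open>
  One half of the equivalence relation on functions. Unlike the two-sided relation it is additive in
  \<open>f\<close>, so the summands of an expression can be bounded separately.
\<close>
definition dominated_on :: "'x set \<Rightarrow> ('x \<Rightarrow> real) \<Rightarrow> ('x \<Rightarrow> real) \<Rightarrow> bool" where
  "dominated_on U f g \<longleftrightarrow> (\<exists>C D. 0 < C \<and> 0 \<le> D \<and> (\<forall>x\<in>U. f x \<le> C * g x + D))"

lemma dominated_onI:
  "0 < C \<Longrightarrow> 0 \<le> D \<Longrightarrow> (\<And>x. x \<in> U \<Longrightarrow> f x \<le> C * g x + D) \<Longrightarrow> dominated_on U f g"
  unfolding dominated_on_def by blast

lemma dominated_onE:
  assumes "dominated_on U f g"
  obtains C D where "0 < C" "0 \<le> D" "\<And>x. x \<in> U \<Longrightarrow> f x \<le> C * g x + D"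
  using assms unfolding dominated_on_def by blast

lemma dominated_on_le: "(\<And>x. x \<in> U \<Longrightarrow> f x \<le> g x) \<Longrightarrow> dominated_on U f g"
  by (rule dominated_onI[of 1 0]) auto

lemma dominated_on_trans:
  assumes "dominated_on U f g" "dominated_on U g h"
  shows "dominated_on U f h"
proof -
  obtain C D where 1: "0 < C" "0 \<le> D" "\<And>x. x \<in> U \<Longrightarrow> f x \<le> C * g x + D"
    using assms(1) by (rule dominated_onE) blast
  obtain C' D' where 2: "0 < C'" "0 \<le> D'" "\<And>x. x \<in> U \<Longrightarrow> g x \<le> C' * h x + D'"
    using assms(2) by (rule dominated_onE) blast
  show ?thesis
  proof (rule dominated_onI[of "C * C'" "C * D' + D"])
    fix x assume x: "x \<in> U"
    have "C * g x \<le> C * (C' * h x + D')" using 2(3)[OF x] 1(1) by (intro mult_left_mono) auto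
    then show "f x \<le> C * C' * h x + (C * D' + D)" using 1(3)[OF x] by (simp add: algebra_simps)
  qed (use 1 2 in auto)
qed

lemma dominated_on_add:
  assumes "dominated_on U f h" "dominated_on U g h"
  shows "dominated_on U (\<lambda>x. f x + g x) h"
proof -
  obtain C D where 1: "0 < C" "0 \<le> D" "\<And>x. x \<in> U \<Longrightarrow> f x \<le> C * h x + D"
    using assms(1) by (rule dominated_onE) blast
  obtain C' D' where 2: "0 < C'" "0 \<le> D'" "\<And>x. x \<in> U \<Longrightarrow> g x \<le> C' * h x + D'"
    using assms(2) by (rule dominated_onE) blast
  show ?thesis
  proof (rule dominated_onI[of "C + C'" "D + D'"])
    fix x assume x: "x \<in> U"
    show "f x + g x \<le> (C + C') * h x + (D + D')"
      using 1(3)[OF x] 2(3)[OF x] by (simp add: algebra_simps)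
  qed (use 1 2 in auto)
qed

text \<open>
  Nonnegativity of \<open>g\<close> is what allows one constant \<open>C\<close> to serve for both inequalities.
\<close>
lemma equivalent_on_iff_dominated:
  assumes "\<And>x. x \<in> U \<Longrightarrow> 0 \<le> g x"
  shows "equivalent_on U f g \<longleftrightarrow> dominated_on U f g \<and> dominated_on U g f"
proof
  assume "equivalent_on U f g"
  then obtain C D where C: "0 < C" "0 \<le> D"
    and fg: "\<And>x. x \<in> U \<Longrightarrow> g x / C - D \<le> f x \<and> f x \<le> C * g x + D"
    unfolding equivalent_on_def by blast
  have "dominated_on U f g" by (rule dominated_onI[of C D]) (use C fg in auto)
  moreover have "dominated_on U g f"
  proof (rule dominated_onI[of C "C * D"])
    fix x assume "x \<in> U"
    then have "g x / C \<le> f x + D" using fg by force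
    then show "g x \<le> C * f x + C * D" using C(1) by (simp add: field_simps)
  qed (use C in auto)
  ultimately show "dominated_on U f g \<and> dominated_on U g f" ..
next
  assume d: "dominated_on U f g \<and> dominated_on U g f"
  then have df: "dominated_on U f g" and dg: "dominated_on U g f" by auto
  obtain C D where 1: "0 < C" "0 \<le> D" "\<And>x. x \<in> U \<Longrightarrow> f x \<le> C * g x + D"
    using df by (rule dominated_onE) blast
  obtain C' D' where 2: "0 < C'" "0 \<le> D'" "\<And>x. x \<in> U \<Longrightarrow> g x \<le> C' * f x + D'"
    using dg by (rule dominated_onE) blast
  have "g x / (C + C') - (D + D' / C') \<le> f x \<and> f x \<le> (C + C') * g x + (D + D' / C')"
    if x: "x \<in> U" for x
  proof
    have "g x / (C + C') \<le> g x / C'" using assms[OF x] 1 2 by (intro divide_left_mono) auto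
    also have "\<dots> \<le> f x + D' / C'" using 2(1) 2(3)[OF x] by (simp add: field_simps)
    finally show "g x / (C + C') - (D + D' / C') \<le> f x" using 1(2) by linarith
    have "0 \<le> C' * g x" "0 \<le> D' / C'" using assms[OF x] 2 by auto
    then show "f x \<le> (C + C') * g x + (D + D' / C')"
      using 1(3)[OF x] by (simp add: distrib_right)
  qed
  moreover have "0 < C + C'" "0 \<le> D + D' / C'" using 1 2 by auto
  ultimately show "equivalent_on U f g" unfolding equivalent_on_def by blast
qed

lemma metric_estimate_iff_dominated:
  "metric_estimate G S E \<longleftrightarrow> dominated_on (carrier G) E (\<lambda>g. real (word_length G S g)) \<and>
    dominated_on (carrier G) (\<lambda>g. real (word_length G S g)) E"
  unfolding metric_estimate_def by (rule equivalent_on_iff_dominated) simp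

context finitely_generated_group
begin

lemma estimate_upper:
  assumes "metric_estimate G S E"
  obtains C where "0 < C" "\<And>g. g \<in> carrier G - {\<one>} \<Longrightarrow> E g \<le> C * real (wl g)"
proof -
  have d: "dominated_on (carrier G) E (\<lambda>g. real (wl g))"
    using assms unfolding metric_estimate_iff_dominated by blast
  obtain C D where 1: "0 < C" "0 \<le> D" "\<And>g. g \<in> carrier G \<Longrightarrow> E g \<le> C * real (wl g) + D"
    using d by (rule dominated_onE) blast
  show thesis
  proof (rule that[of "C + D"])
    fix g assume g: "g \<in> carrier G - {\<one>}"
    have "1 \<le> real (wl g)" using wl_pos[of g] g by simp
    then have "D * 1 \<le> D * real (wl g)" using 1(2) by (intro mult_left_mono) auto
    then show "E g \<le> (C + D) * real (wl g)" using 1(3)[of g] g by (simp add: distrib_right)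
  qed (use 1 in auto)
qed

text \<open>
  Outside the ball of radius \<open>2 D\<close>, the additive error is at most half of the length and can be absorbed.
  Inside the ball there are finitely many elements, on which the ratio of length to estimate is bounded.
\<close>
lemma positive_estimate_lower:
  assumes est: "metric_estimate G S E" and pos: "pos_off_one G E"
  obtains C where "0 < C" "\<And>g. g \<in> carrier G - {\<one>} \<Longrightarrow> real (wl g) \<le> C * E g"
proof -
  have d: "dominated_on (carrier G) (\<lambda>g. real (wl g)) E"
    using est unfolding metric_estimate_iff_dominated by blast
  obtain C D where 1: "0 < C" "0 \<le> D" "\<And>g. g \<in> carrier G \<Longrightarrow> real (wl g) \<le> C * E g + D"
    using d by (rule dominated_onE) blast
  have E: "0 < E g" if "g \<in> carrier G - {\<one>}" for g
    using pos that unfolding pos_off_one_def by blast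
  \<comment> \<open>A sum of nonnegative ratios over the ball serves as an upper bound for each of them.\<close>
  let ?N = "{g \<in> carrier G. wl g \<le> nat \<lceil>2 * D\<rceil>} - {\<one>}"
  define M where "M = (\<Sum>g\<in>?N. real (wl g) / E g)"
  have nonneg: "0 \<le> real (wl g) / E g" if "g \<in> ?N" for g
    using E[of g] that by (simp add: less_imp_le)
  have M: "0 \<le> M" unfolding M_def using nonneg by (rule sum_nonneg)
  show thesis
  proof (rule that[of "2 * C + M"])
    fix g assume g: "g \<in> carrier G - {\<one>}"
    have Eg: "0 < E g" by (rule E[OF g])
    show "real (wl g) \<le> (2 * C + M) * E g"
    proof (cases "wl g \<le> nat \<lceil>2 * D\<rceil>")
      case True
      have "real (wl g) / E g \<le> M" unfolding M_def
        using g True nonneg finite_ball by (intro member_le_sum) auto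
      then have "real (wl g) \<le> M * E g" using Eg by (simp add: field_simps)
      moreover have "0 \<le> 2 * C * E g" using 1(1) Eg by simp
      ultimately show ?thesis by (simp add: distrib_right)
    next
      case False
      then have "2 * D \<le> real (wl g)" by linarith
      then have "real (wl g) \<le> 2 * C * E g" using 1(3)[of g] g by simp
      moreover have "0 \<le> M * E g" using M Eg by simp
      ultimately show ?thesis by (simp add: distrib_right)
    qed
  qed (use 1 M in auto)
qed

lemma pair_weight_edge:
  assumes "pair_weight G E w" "V \<subseteq> carrier G" "e \<in> complete_edges V"
  obtains g where "g \<in> carrier G - {\<one>}" "w e = E g" "dist_weight G S e = real (wl g)"
proof -
  obtain b c where e: "e = {b, c}" "b \<in> carrier G" "c \<in> carrier G" "b \<noteq> c"
    using assms(2,3) unfolding complete_edges_def by blast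
  have ne: "inv x \<otimes> y \<noteq> \<one>" if "x \<in> carrier G" "y \<in> carrier G" "x \<noteq> y" for x y
    using that by (metis inv_closed inv_equality inv_inv)
  have "w {b, c} = E (inv b \<otimes> c) \<or> w {b, c} = E (inv c \<otimes> b)"
    using assms(1) e unfolding pair_weight_def by blast
  then show thesis
  proof
    assume "w {b, c} = E (inv b \<otimes> c)"
    then show thesis using that[of "inv b \<otimes> c"] ne[of b c] e dist_weight_eq[of b c] by simp
  next
    assume "w {b, c} = E (inv c \<otimes> b)"
    then show thesis using that[of "inv c \<otimes> b"] ne[of c b] e dist_weight_eq[of c b]
      by (simp add: insert_commute)
  qed
qed

end

section \<open>Estimates of the metric of the wreath product\<close>

context finitely_generated_wreath
begin

abbreviation "norm_W \<equiv> \<lambda>x. real (word_length W gens x)"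
abbreviation "value_norm \<equiv> value_sum A B (\<lambda>a. real (A.wl a))"
abbreviation "dominated \<equiv> dominated_on (carrier W)"

lemma norm_W_eq: "x \<in> carrier W \<Longrightarrow> norm_W x = value_norm x + tau A B T x"
  by (simp add: word_length_wreath value_length_def value_sum_def tau_def)

text \<open>
  An additive error in comparing two functions on \<open>A\<close> is incurred once for every support point.
\<close>
lemma value_sum_affine_le:
  assumes "\<And>a. a \<in> carrier A - {\<one>\<^bsub>A\<^esub>} \<Longrightarrow> F a \<le> C * F' a + D" "x \<in> carrier W"
  shows "value_sum A B F x \<le> C * value_sum A B F' x + D * real (card (supp A B x))"
proof -
  have "fst x \<in> base" using assms(2) by (auto simp: carrier_W)
  then have "value_sum A B F x \<le> (\<Sum>b\<in>supp A B x. C * F' (fst x b) + D)"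
    unfolding value_sum_def using base_value_closed
    by (intro sum_mono assms(1)) (auto simp: supp_def)
  then show ?thesis by (simp add: value_sum_def sum.distrib sum_distrib_left mult.commute)
qed

lemma value_sum_nonneg:
  assumes "nonneg_off_one A F" "x \<in> carrier W"
  shows "0 \<le> value_sum A B F x"
  using value_sum_affine_le[of "\<lambda>_. 0" 1 F 0 x] assms
  by (simp add: nonneg_off_one_def value_sum_def)

lemma value_norm_nonneg: "0 \<le> value_norm x"
  by (simp add: value_sum_def sum_nonneg)

lemma tau_nonneg: "0 \<le> tau A B T x"
  by (simp add: tau_def)

lemma tree_vertices_finite: "x \<in> carrier W \<Longrightarrow> finite (tree_vertices A B x)"
  by (simp add: tree_vertices_def finite_supp)

lemma tree_vertices_closed: "x \<in> carrier W \<Longrightarrow> tree_vertices A B x \<subseteq> carrier B"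
  using supp_closed[of x] by (auto simp: tree_vertices_def carrier_W)

lemma mu_le_tau: "x \<in> carrier W \<Longrightarrow> mu A B T x \<le> tau A B T x"
  unfolding mu_def tau_def tree_vertices_def
  by (rule B.mst_le_tsp_length) (auto simp: finite_supp supp_closed carrier_W)

lemma tau_le_mu: "x \<in> carrier W \<Longrightarrow> tau A B T x \<le> 4 * mu A B T x"
  unfolding mu_def tau_def tree_vertices_def
  by (rule B.tsp_length_le_mst) (auto simp: finite_supp supp_closed carrier_W)

lemma card_supp_le_tau: "x \<in> carrier W \<Longrightarrow> real (card (supp A B x)) \<le> tau A B T x + 1"
  using B.card_le_tsp_length[of "supp A B x" "\<one>\<^bsub>B\<^esub>" "snd x"]
  by (auto simp: finite_supp supp_closed carrier_W tau_def)

lemma card_supp_le_value_norm: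
  assumes "x \<in> carrier W"
  shows "real (card (supp A B x)) \<le> value_norm x"
  using value_sum_affine_le[of "\<lambda>_. 1" 1 "\<lambda>a. real (A.wl a)" 0 x] A.wl_pos assms
  by (simp add: value_sum_def)

lemma card_tree_vertices_le:
  assumes "x \<in> carrier W"
  shows "real (card (tree_vertices A B x)) \<le> value_norm x + 2"
proof -
  have "card (tree_vertices A B x) \<le> card {\<one>\<^bsub>B\<^esub>, snd x} + card (supp A B x)"
    unfolding tree_vertices_def by (rule card_Un_le)
  also have "card {\<one>\<^bsub>B\<^esub>, snd x} \<le> 2" by (simp add: card_insert_if)
  finally show ?thesis using card_supp_le_value_norm[OF assms] by linarith
qed

lemma mu_nonneg: "x \<in> carrier W \<Longrightarrow> 0 \<le> mu A B T x"
  using tau_le_mu[of x] tau_nonneg[of x] by linarith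

lemma cursor_le_tau: "x \<in> carrier W \<Longrightarrow> real (B.wl (snd x)) \<le> tau A B T x"
  using B.gdist_le_tsp_length[of "supp A B x" "\<one>\<^bsub>B\<^esub>" "snd x"]
  by (auto simp: finite_supp supp_closed carrier_W tau_def)

lemma tau_dominated: "dominated (tau A B T) norm_W"
  by (rule dominated_on_le) (simp add: norm_W_eq value_norm_nonneg)

lemma mu_dominated: "dominated (mu A B T) norm_W"
  by (rule dominated_on_trans[OF _ tau_dominated]) (rule dominated_on_le, rule mu_le_tau)

lemma value_norm_dominated: "dominated value_norm norm_W"
  by (rule dominated_on_le) (simp add: norm_W_eq tau_nonneg)

text \<open>
  A lower bound for an expression need only control the two summands separately, and \<open>\<tau>\<close> may be
  replaced by \<open>\<mu>\<close>.
\<close>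
lemma norm_W_dominatedI:
  assumes "dominated value_norm h" "dominated (mu A B T) h"
  shows "dominated norm_W h"
proof -
  have "dominated (tau A B T) (mu A B T)"
    by (rule dominated_onI[of 4 0]) (use tau_le_mu in auto)
  then have "dominated (\<lambda>x. value_norm x + tau A B T x) h"
    using dominated_on_add[OF assms(1)] dominated_on_trans assms(2) by blast
  moreover have "dominated norm_W (\<lambda>x. value_norm x + tau A B T x)"
    by (rule dominated_on_le) (simp add: norm_W_eq)
  ultimately show ?thesis using dominated_on_trans by blast
qed

lemma estimate_value_norm_mu: "metric_estimate W gens (\<lambda>x. value_norm x + mu A B T x)"
  unfolding metric_estimate_iff_dominated
proof
  show "dominated (\<lambda>x. value_norm x + mu A B T x) norm_W" by (rule dominated_on_add[OF value_norm_dominated mu_dominated])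
  show "dominated norm_W (\<lambda>x. value_norm x + mu A B T x)"
    by (rule norm_W_dominatedI; rule dominated_on_le) (simp_all add: value_norm_nonneg mu_nonneg)
qed

text \<open>
  The cursor position satisfies \<open>\<parallel>b\<^sub>f\<parallel> \<le> \<tau> \<le> \<parallel>x\<parallel>\<close>, and an estimate is bounded below by a constant.
\<close>
lemma estimate_add_cursor:
  assumes est: "metric_estimate B T E" and f: "metric_estimate W gens f"
  shows "metric_estimate W gens (\<lambda>x. f x + E (snd x))"
  unfolding metric_estimate_iff_dominated
proof
  have d: "dominated_on (carrier B) E (\<lambda>b. real (B.wl b))"
    "dominated_on (carrier B) (\<lambda>b. real (B.wl b)) E"
    using est unfolding metric_estimate_iff_dominated by auto
  have fd: "dominated f norm_W" "dominated norm_W f" using f unfolding metric_estimate_iff_dominated by auto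
  have snd: "snd x \<in> carrier B" if "x \<in> carrier W" for x using that by (auto simp: carrier_W)
  have 1: "dominated (\<lambda>x. E (snd x)) (\<lambda>x. real (B.wl (snd x)))"
    using d(1) snd unfolding dominated_on_def by blast
  have 2: "dominated (\<lambda>x. real (B.wl (snd x))) (tau A B T)"
    by (rule dominated_on_le) (rule cursor_le_tau)
  have "dominated (\<lambda>x. E (snd x)) norm_W"
    by (rule dominated_on_trans[OF 1 dominated_on_trans[OF 2 tau_dominated]])
  then show "dominated (\<lambda>x. f x + E (snd x)) norm_W" by (rule dominated_on_add[OF fd(1)])
  obtain C D where CD: "0 < C" "0 \<le> D" "\<And>b. b \<in> carrier B \<Longrightarrow> real (B.wl b) \<le> C * E b + D"
    using d(2) by (rule dominated_onE) blast
  have "dominated f (\<lambda>x. f x + E (snd x))"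
  proof (rule dominated_onI[of 1 "D / C"])
    fix x assume "x \<in> carrier W"
    then have "real (B.wl (snd x)) \<le> C * E (snd x) + D" by (rule CD(3)[OF snd])
    then have "0 \<le> C * E (snd x) + D" by simp
    then have "0 \<le> E (snd x) + D / C" using CD(1) by (simp add: field_simps)
    then show "f x \<le> 1 * (f x + E (snd x)) + D / C" by simp
  qed (use CD in auto)
  then show "dominated norm_W (\<lambda>x. f x + E (snd x))" by (rule dominated_on_trans[OF fd(2)])
qed

lemma value_sum_dominated:
  assumes "metric_estimate A S E"
  shows "dominated (value_sum A B E) norm_W"
proof -
  obtain C where C: "0 < C" "\<And>a. a \<in> carrier A - {\<one>\<^bsub>A\<^esub>} \<Longrightarrow> E a \<le> C * real (A.wl a)"
    using A.estimate_upper[OF assms] by blast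
  have "dominated (value_sum A B E) value_norm"
    by (rule dominated_onI[of C 0]) (use C value_sum_affine_le[of E C _ 0] in auto)
  then show ?thesis by (rule dominated_on_trans[OF _ value_norm_dominated])
qed

lemma mu_hat_affine_le:
  assumes "pair_weight B E w" "0 \<le> C" "x \<in> carrier W"
    and "\<And>b. b \<in> carrier B - {\<one>\<^bsub>B\<^esub>} \<Longrightarrow> E b \<le> C * real (B.wl b)"
  shows "mu_hat A B w x \<le> C * mu A B T x"
proof -
  have "w e \<le> C * dist_weight B T e + 0" if "e \<in> complete_edges (tree_vertices A B x)" for e
    using B.pair_weight_edge[OF assms(1) tree_vertices_closed[OF assms(3)] that] assms(4)
    by (metis add.right_neutral)
  then show ?thesis unfolding mu_hat_def mu_def
    using mst_weight_affine_le[of "tree_vertices A B x" C 0 w "dist_weight B T"]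
      tree_vertices_finite[OF assms(3)] assms(2) by (simp add: tree_vertices_def)
qed

lemma mu_affine_le:
  assumes "pair_weight B E w" "0 \<le> C" "0 \<le> D" "x \<in> carrier W"
    and "\<And>b. b \<in> carrier B - {\<one>\<^bsub>B\<^esub>} \<Longrightarrow> real (B.wl b) \<le> C * E b + D"
  shows "mu A B T x \<le> C * mu_hat A B w x + D * real (card (tree_vertices A B x))"
proof -
  have "dist_weight B T e \<le> C * w e + D" if "e \<in> complete_edges (tree_vertices A B x)" for e
    using B.pair_weight_edge[OF assms(1) tree_vertices_closed[OF assms(4)] that] assms(5)
    by metis
  then show ?thesis unfolding mu_hat_def mu_def
    using mst_weight_affine_le[of "tree_vertices A B x" C D "dist_weight B T" w]
      tree_vertices_finite[OF assms(4)] assms(2,3) by (simp add: tree_vertices_def)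
qed

lemma mu_hat_dominated:
  assumes "metric_estimate B T E" "pair_weight B E w"
  shows "dominated (mu_hat A B w) norm_W"
proof -
  obtain C where C: "0 < C" "\<And>b. b \<in> carrier B - {\<one>\<^bsub>B\<^esub>} \<Longrightarrow> E b \<le> C * real (B.wl b)"
    using B.estimate_upper[OF assms(1)] by blast
  have "dominated (mu_hat A B w) (mu A B T)"
    by (rule dominated_onI[of C 0]) (use C mu_hat_affine_le[OF assms(2)] in auto)
  then show ?thesis by (rule dominated_on_trans[OF _ mu_dominated])
qed

lemma mu_hat_nonneg:
  assumes "nonneg_off_one B E" "pair_weight B E w" "x \<in> carrier W"
  shows "0 \<le> mu_hat A B w x"
  unfolding mu_hat_def
proof (rule mst_weight_nonneg[OF tree_vertices_finite[OF assms(3)]])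
  fix e assume "e \<in> complete_edges (tree_vertices A B x)"
  then show "0 \<le> w e"
    using B.pair_weight_edge[OF assms(2) tree_vertices_closed[OF assms(3)]] assms(1)
    unfolding nonneg_off_one_def by metis
qed

text \<open>
  The accumulated error \<open>D s\<close> is absorbed by the spanning tree, as \<open>s \<le> \<tau> + 1 \<le> 4 \<mu> + 1\<close>.
\<close>
lemma norm_W_dominated_by_value_sum_mu:
  assumes "metric_estimate A S E" "nonneg_off_one A E"
  shows "dominated norm_W (\<lambda>x. value_sum A B E x + mu A B T x)"
proof (rule norm_W_dominatedI)
  have d: "dominated_on (carrier A) (\<lambda>a. real (A.wl a)) E"
    using assms(1) unfolding metric_estimate_iff_dominated by auto
  obtain C D where CD: "0 < C" "0 \<le> D" "\<And>a. a \<in> carrier A \<Longrightarrow> real (A.wl a) \<le> C * E a + D"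
    using d by (rule dominated_onE) blast
  show "dominated value_norm (\<lambda>x. value_sum A B E x + mu A B T x)"
  proof (rule dominated_onI[of "C + 4 * D" D])
    fix x assume x: "x \<in> carrier W"
    let ?V = "value_sum A B E x" and ?m = "mu A B T x"
    have "value_norm x \<le> C * ?V + D * real (card (supp A B x))"
      by (rule value_sum_affine_le[OF _ x]) (use CD(3) in auto)
    also have "D * real (card (supp A B x)) \<le> D * (4 * ?m + 1)"
      using card_supp_le_tau[OF x] tau_le_mu[OF x] CD(2) by (intro mult_left_mono) auto
    finally have "value_norm x \<le> C * ?V + D * (4 * ?m + 1)" by simp
    moreover have "0 \<le> C * ?m" "0 \<le> D * ?V"
      using CD mu_nonneg[OF x] value_sum_nonneg[OF assms(2) x] by auto
    ultimately show "value_norm x \<le> (C + 4 * D) * (?V + ?m) + D" by (simp add: algebra_simps)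
  qed (use CD in auto)
  show "dominated (mu A B T) (\<lambda>x. value_sum A B E x + mu A B T x)"
    by (rule dominated_on_le) (simp add: value_sum_nonneg[OF assms(2)])
qed

text \<open>
  The accumulated error, at most \<open>D (s + 2)\<close> as the tree has at most \<open>s + 2\<close> vertices, is absorbed by the
  values, since \<open>s \<le> \<Sum> \<parallel>a\<^sub>i\<parallel>\<close>.
\<close>
lemma norm_W_dominated_by_value_norm_mu_hat:
  assumes "metric_estimate B T E" "nonneg_off_one B E" "pair_weight B E w"
  shows "dominated norm_W (\<lambda>x. value_norm x + mu_hat A B w x)"
proof (rule norm_W_dominatedI)
  have d: "dominated_on (carrier B) (\<lambda>b. real (B.wl b)) E"
    using assms(1) unfolding metric_estimate_iff_dominated by auto
  obtain C D where CD: "0 < C" "0 \<le> D" "\<And>b. b \<in> carrier B \<Longrightarrow> real (B.wl b) \<le> C * E b + D"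
    using d by (rule dominated_onE) blast
  show "dominated value_norm (\<lambda>x. value_norm x + mu_hat A B w x)"
    by (rule dominated_on_le) (simp add: mu_hat_nonneg[OF assms(2,3)])
  show "dominated (mu A B T) (\<lambda>x. value_norm x + mu_hat A B w x)"
  proof (rule dominated_onI[of "C + D" "2 * D"])
    fix x assume x: "x \<in> carrier W"
    let ?h = "mu_hat A B w x"
    have "mu A B T x \<le> C * ?h + D * real (card (tree_vertices A B x))"
      by (rule mu_affine_le[OF assms(3) _ _ x]) (use CD in auto)
    also have "D * real (card (tree_vertices A B x)) \<le> D * (value_norm x + 2)"
      using card_tree_vertices_le[OF x] CD(2) by (intro mult_left_mono) auto
    finally have "mu A B T x \<le> C * ?h + D * (value_norm x + 2)" by simp
    moreover have "0 \<le> C * value_norm x" "0 \<le> D * ?h"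
      using CD value_norm_nonneg[of x] mu_hat_nonneg[OF assms(2,3) x] by auto
    ultimately show "mu A B T x \<le> (C + D) * (value_norm x + ?h) + 2 * D" by (simp add: algebra_simps)
  qed (use CD in auto)
qed

text \<open>
  The estimate that is positive off the identity bounds its metric from above without additive error, which reduces
  the claim to one of the two cases where only one metric has been replaced.
\<close>
lemma norm_W_dominated_by_value_sum_mu_hat:
  assumes A: "metric_estimate A S EA" "nonneg_off_one A EA"
    and B: "metric_estimate B T EB" "nonneg_off_one B EB" "pair_weight B EB w"
    and pos: "pos_off_one A EA \<or> pos_off_one B EB"
  shows "dominated norm_W (\<lambda>x. value_sum A B EA x + mu_hat A B w x)"
  using pos
proof
  assume "pos_off_one A EA"
  then obtain C where C: "0 < C" "\<And>a. a \<in> carrier A - {\<one>\<^bsub>A\<^esub>} \<Longrightarrow> real (A.wl a) \<le> C * EA a"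
    using A.positive_estimate_lower[OF A(1)] by blast
  have "dominated (\<lambda>x. value_norm x + mu_hat A B w x) (\<lambda>x. value_sum A B EA x + mu_hat A B w x)"
  proof (rule dominated_onI[of "C + 1" 0])
    fix x assume x: "x \<in> carrier W"
    have "value_norm x \<le> C * value_sum A B EA x"
      using value_sum_affine_le[OF _ x, of "\<lambda>a. real (A.wl a)" C EA 0] C(2) by simp
    moreover have "0 \<le> C * mu_hat A B w x" "0 \<le> value_sum A B EA x"
      using C(1) mu_hat_nonneg[OF B(2,3) x] value_sum_nonneg[OF A(2) x] by auto
    ultimately show "value_norm x + mu_hat A B w x
        \<le> (C + 1) * (value_sum A B EA x + mu_hat A B w x) + 0" by (simp add: algebra_simps)
  qed (use C in auto)
  then show ?thesis by (rule dominated_on_trans[OF norm_W_dominated_by_value_norm_mu_hat[OF B]])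
next
  assume "pos_off_one B EB"
  then obtain C where C: "0 < C" "\<And>b. b \<in> carrier B - {\<one>\<^bsub>B\<^esub>} \<Longrightarrow> real (B.wl b) \<le> C * EB b"
    using B.positive_estimate_lower[OF B(1)] by blast
  have "dominated (\<lambda>x. value_sum A B EA x + mu A B T x) (\<lambda>x. value_sum A B EA x + mu_hat A B w x)"
  proof (rule dominated_onI[of "C + 1" 0])
    fix x assume x: "x \<in> carrier W"
    have "mu A B T x \<le> C * mu_hat A B w x"
      using mu_affine_le[OF B(3) _ _ x, of C 0] C by simp
    moreover have "0 \<le> mu_hat A B w x" "0 \<le> C * value_sum A B EA x"
      using C(1) mu_hat_nonneg[OF B(2,3) x] value_sum_nonneg[OF A(2) x] by auto
    ultimately show "value_sum A B EA x + mu A B T x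
        \<le> (C + 1) * (value_sum A B EA x + mu_hat A B w x) + 0" by (simp add: algebra_simps)
  qed (use C in auto)
  then show ?thesis by (rule dominated_on_trans[OF norm_W_dominated_by_value_sum_mu[OF A]])
qed

end

theorem theorem2p4:
  fixes A :: "('a, 'm) monoid_scheme" and B :: "('b, 'n) monoid_scheme"
    and S :: "'a set" and T :: "'b set"
    and EA :: "'a \<Rightarrow> real" and EB :: "'b \<Rightarrow> real" and w :: "'b set \<Rightarrow> real"
  assumes "group A" and "fin_generating A S"
    and "group B" and "fin_generating B T"
    and "metric_estimate A S EA" and "metric_estimate B T EB"
    and "pair_weight B EB w"
  shows
    "metric_estimate (wreath A B) (wreath_gens A B S T)
       (\<lambda>x. value_sum A B (word_length A S) x + mu A B T x) \<and>
     (nonneg_off_one A EA \<longrightarrow>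
        metric_estimate (wreath A B) (wreath_gens A B S T)
          (\<lambda>x. value_sum A B EA x + tau A B T x)) \<and>
     (nonneg_off_one A EA \<longrightarrow>
        metric_estimate (wreath A B) (wreath_gens A B S T)
          (\<lambda>x. value_sum A B EA x + mu A B T x)) \<and>
     (nonneg_off_one B EB \<longrightarrow>
        metric_estimate (wreath A B) (wreath_gens A B S T)
          (\<lambda>x. value_sum A B (word_length A S) x + mu_hat A B w x)) \<and>
     (nonneg_off_one A EA \<and> nonneg_off_one B EB \<and> (pos_off_one A EA \<or> pos_off_one B EB) \<longrightarrow>
        metric_estimate (wreath A B) (wreath_gens A B S T)
          (\<lambda>x. value_sum A B EA x + mu_hat A B w x)) \<and>
     metric_estimate (wreath A B) (wreath_gens A B S T)
       (\<lambda>x. value_sum A B (word_length A S) x + mu A B T x + EB (snd x)) \<and>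
     (nonneg_off_one A EA \<and> nonneg_off_one B EB \<and> (pos_off_one A EA \<or> pos_off_one B EB) \<longrightarrow>
        metric_estimate (wreath A B) (wreath_gens A B S T)
          (\<lambda>x. value_sum A B EA x + mu_hat A B w x + EB (snd x)))"
proof -
  interpret finitely_generated_wreath A S B T
    by (simp add: finitely_generated_wreath_def finitely_generated_group_def
        finitely_generated_group_axioms_def assms(1-4))
  note EA = assms(5) and EB = assms(6) and w = assms(7)
  note upper = value_sum_dominated[OF EA] mu_hat_dominated[OF EB w]
  have tau: "metric_estimate W gens (\<lambda>x. value_sum A B EA x + tau A B T x)"
    and mu: "metric_estimate W gens (\<lambda>x. value_sum A B EA x + mu A B T x)"
    if "nonneg_off_one A EA"
  proof -
    note lower = norm_W_dominated_by_value_sum_mu[OF EA that]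
    show "metric_estimate W gens (\<lambda>x. value_sum A B EA x + mu A B T x)"
      unfolding metric_estimate_iff_dominated
      using dominated_on_add[OF upper(1) mu_dominated] lower by blast
    have "dominated (\<lambda>x. value_sum A B EA x + mu A B T x) (\<lambda>x. value_sum A B EA x + tau A B T x)"
      by (rule dominated_on_le) (simp add: mu_le_tau)
    then show "metric_estimate W gens (\<lambda>x. value_sum A B EA x + tau A B T x)"
      unfolding metric_estimate_iff_dominated
      using dominated_on_add[OF upper(1) tau_dominated] dominated_on_trans[OF lower] by blast
  qed
  have norm_mu_hat: "metric_estimate W gens (\<lambda>x. value_norm x + mu_hat A B w x)"
    if "nonneg_off_one B EB"
    unfolding metric_estimate_iff_dominated
    using dominated_on_add[OF value_norm_dominated upper(2)] norm_W_dominated_by_value_norm_mu_hat[OF EB that w]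
    by blast
  have value_mu_hat: "metric_estimate W gens (\<lambda>x. value_sum A B EA x + mu_hat A B w x)"
    if "nonneg_off_one A EA \<and> nonneg_off_one B EB \<and> (pos_off_one A EA \<or> pos_off_one B EB)"
    unfolding metric_estimate_iff_dominated
    using dominated_on_add[OF upper] norm_W_dominated_by_value_sum_mu_hat[OF EA _ EB _ w] that
    by blast
  show ?thesis
    using estimate_value_norm_mu tau mu norm_mu_hat value_mu_hat
      estimate_add_cursor[OF EB estimate_value_norm_mu] estimate_add_cursor[OF EB value_mu_hat]
    by blast
qed

end
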